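(* Let $n,k\ge 1$ be integers. A square complex orthogonal design of size $[n,n,k]$ exists if and only if $2^{k-1}\mid n$. Moreover, if $\mathcal{O}_z$ is any square complex orthogonal design of size $[n,n,k]$, then there exist unitary matrices $U,V\in U_n(\mathbb{C})$ and unique nonnegative integers $n_1,n_2$ with $n_1+n_2=n/2^{k-1}$ such that $$\mathcal{O}_z = U\,\mathrm{diag}(\underbrace{\mathcal{C}_k,\ldots,\mathcal{C}_k}_{n_1},\underbrace{\mathcal{C}^-_k,\ldots,\mathcal{C}^-_k}_{n_2})\,V = U\big((I_{n_1}\otimes\mathcal{C}_k)\oplus(I_{n_2}\otimes\mathcal{C}^-_k)\big)V.$$
   Context: Let $z_1,\ldots,z_k$ be formal complex indeterminates, with $z_i^*$ the complex conjugate. A complex orthogonal design (COD) of size $[p,n,k]$ is a $p\times n$ matrix $\mathcal{O}_z$ each of whose entries is a complex linear combination of $z_1,\ldots,z_k,z_1^*,\ldots,z_k^*$, such that $\mathcal{O}_z^H\mathcal{O}_z=(|z_1|^2+\cdots+|z_k|^2)I_n$ (equivalently, $\mathcal{O}_z$ is unitary whenever $\sum|z_i|^2=1$). It is a square COD if $p=n$. Define recursively $\mathcal{C}_1=(z_1)$ and, for $k>1$, the $2^{k-1}\times 2^{k-1}$ matrix $$\mathcal{C}_k=\begin{pmatrix}\mathcal{C}_{k-1} & z_k I_{2^{k-2}}\\ -z_k^* I_{2^{k-2}} & \mathcal{C}_{k-1}^H\end{pmatrix}.$$ Let $\mathcal{C}_k^-$ be the matrix obtained from $\mathcal{C}_k$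 by replacing $z_k$ with $z_k^*$ (and hence $z_k^*$ with $z_k$). $U_n(\mathbb{C})$ denotes the group of $n\times n$ unitary matrices. *)

theory Defs
  imports "HOL-Analysis.Analysis" "Jordan_Normal_Form.Matrix"
begin

definition cadj :: "complex mat \<Rightarrow> complex mat" where
  "cadj A = mat (dim_col A) (dim_row A) (\<lambda>(i,j). cnj (A $$ (j,i)))"

definition unitary_mat :: "nat \<Rightarrow> complex mat \<Rightarrow> bool" where
  "unitary_mat n U \<longleftrightarrow> U \<in> carrier_mat n n \<and> cadj U * U = 1\<^sub>m n"

text \<open>A square n x n matrix whose entries are complex linear combinations of
  z_1,...,z_k, z_1^*,...,z_k^*. The formal variable z_{i+1} is represented by index i;
  the coefficient of z_{i+1} in entry (a,b) is alpha a b i, that of z_{i+1}^* is beta a b i.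
  The function below evaluates the formal matrix at the point z.\<close>
definition lin_mat :: "nat \<Rightarrow> nat \<Rightarrow> (nat \<Rightarrow> nat \<Rightarrow> nat \<Rightarrow> complex) \<Rightarrow>
    (nat \<Rightarrow> nat \<Rightarrow> nat \<Rightarrow> complex) \<Rightarrow> (nat \<Rightarrow> complex) \<Rightarrow> complex mat" where
  "lin_mat n k \<alpha> \<beta> z =
     mat n n (\<lambda>(a,b). \<Sum>i<k. \<alpha> a b i * z i + \<beta> a b i * cnj (z i))"

text \<open>Square complex orthogonal design of size [n,n,k]: O^H O = (|z_1|^2+...+|z_k|^2) I_n
  as an identity in the indeterminates (i.e. for all values of z).\<close>
definition square_COD :: "nat \<Rightarrow> nat \<Rightarrow> (nat \<Rightarrow> nat \<Rightarrow> nat \<Rightarrow> complex) \<Rightarrow>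
    (nat \<Rightarrow> nat \<Rightarrow> nat \<Rightarrow> complex) \<Rightarrow> bool" where
  "square_COD n k \<alpha> \<beta> \<longleftrightarrow>
     (\<forall>z. cadj (lin_mat n k \<alpha> \<beta> z) * lin_mat n k \<alpha> \<beta> z
          = complex_of_real (\<Sum>i<k. (cmod (z i))\<^sup>2) \<cdot>\<^sub>m 1\<^sub>m n)"

text \<open>The designs C_k (evaluated at z), k \<ge> 1; z_j is z (j-1).\<close>
fun Cdes :: "nat \<Rightarrow> (nat \<Rightarrow> complex) \<Rightarrow> complex mat" where
  "Cdes 0 z = 0\<^sub>m 0 0"
| "Cdes (Suc 0) z = mat 1 1 (\<lambda>_. z 0)"
| "Cdes (Suc (Suc m)) z =
     four_block_mat (Cdes (Suc m) z) (z (Suc m) \<cdot>\<^sub>m 1\<^sub>m (2^m))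
                    ((- cnj (z (Suc m))) \<cdot>\<^sub>m 1\<^sub>m (2^m)) (cadj (Cdes (Suc m) z))"

definition Cdes_minus :: "nat \<Rightarrow> (nat \<Rightarrow> complex) \<Rightarrow> complex mat" where
  "Cdes_minus k z = Cdes k (z(k - 1 := cnj (z (k - 1))))"

end

theory Submission
  imports Defs "Jordan_Normal_Form.Determinant"
begin

text \<open>
  Two matrix families are equivalent if they differ by constant unitary factors on the left and on the
  right. Normalising the coefficients of the last variable \<open>w\<close> to sum to the identity turns
  one of them into a Hermitian projection; after diagonalising it, a design in one more variable has
  the form \<open>(w I, Y; - Y\<^sup>H, w\<^sup>* I)\<close>, and if other variables remain then both
  diagonal blocks have the same size and \<open>Y\<close> is a square design in the other variables. So every
  design is equivalent to \<open>(Y, w I; - w\<^sup>* I, Y\<^sup>H)\<close>, which is how the designs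
  \<open>C\<^sub>k\<close> are built. This extension respects equivalence in both directions and, up to a
  permutation, direct sums; it takes \<open>C\<^sub>k\<close> to the next \<open>C\<close> and
  \<open>C\<^sub>k\<^sup>-\<close> to something equivalent to the next \<open>C\<^sup>-\<close>. Existence and
  uniqueness of the multiplicities therefore reduce by induction to one variable, where they are
  the ranks of the coefficients of \<open>z\<close> and of its conjugate.
\<close>

section \<open>Adjoints and unitary matrices\<close>

text \<open>With more than one variable, ranks no longer separate the two kinds of block: in
  \<open>Cdes k\<close> and in \<open>Cdes_minus k\<close> alike the coefficients of the last
  variable and of its conjugate both have rank half the size. The multiplicities are visible only at
  the bottom, where a diagonal entry is either the variable or its conjugate. Uniqueness therefore
  needs an extension step that can be cancelled, and this rests on w and \<open>cnj w\<close> being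
  linearly independent over the complex numbers, tested at w = 1 and w = \<i>. At the bottom it is
  the first variable that is conjugated, whereas \<open>Cdes_minus\<close> conjugates the top one.
  Block swaps bridge this: exchanging the two halves of an extension trades the pair w, A for
  \<open>cnj w\<close>, A^H, so with each extension the conjugation climbs from the previous
  variable to the new one. That the diagonal blocks have equal size is a count: at a point of norm 1
  whose last variable is 0, the normalised design is unitary and its nonzero entries only join
  indices of different blocks.\<close>

lemma mult_assoc_dim:
  fixes A B C :: "'a::semiring_0 mat"
  shows "dim_col A = dim_row B \<Longrightarrow> dim_col B = dim_row C \<Longrightarrow> A * B * C = A * (B * C)"
  by (rule assoc_mult_mat[of A "dim_row A" "dim_col A" B "dim_col B" C "dim_col C"]) auto

lemma mult_add_dim:
  fixes A B C :: "'a::semiring_0 mat"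
  shows "dim_row C = dim_row B \<Longrightarrow> dim_col C = dim_col B \<Longrightarrow> dim_col A = dim_row B \<Longrightarrow>
    A * (B + C) = A * B + A * C"
  by (rule mult_add_distrib_mat[of A "dim_row A" "dim_col A" B "dim_col B" C]) auto

lemma add_mult_dim:
  fixes A B C :: "'a::semiring_0 mat"
  shows "dim_row A = dim_row B \<Longrightarrow> dim_col A = dim_col B \<Longrightarrow> dim_col A = dim_row C \<Longrightarrow>
    (A + B) * C = A * C + B * C"
  by (rule add_mult_distrib_mat[of A "dim_row A" "dim_col A" B C "dim_col C"]) auto

lemma smult_mult_dim:
  fixes A B :: "'a::comm_semiring_0 mat"
  shows "dim_col A = dim_row B \<Longrightarrow> (c \<cdot>\<^sub>m A) * B = c \<cdot>\<^sub>m (A * B)"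
  by (rule mult_smult_assoc_mat[of A "dim_row A" "dim_col A" B "dim_col B"]) auto

lemma mult_smult_dim:
  fixes A B :: "'a::comm_semiring_0 mat"
  shows "dim_col A = dim_row B \<Longrightarrow> A * (c \<cdot>\<^sub>m B) = c \<cdot>\<^sub>m (A * B)"
  by (rule mult_smult_distrib[of A "dim_row A" "dim_col A" B "dim_col B"]) auto

lemma zero_add_dim: "dim_row A = m \<Longrightarrow> dim_col A = n \<Longrightarrow> 0\<^sub>m m n + A = (A :: 'a::monoid_add mat)"
  by (auto intro: left_add_zero_mat)

lemma add_zero_dim: "dim_row A = m \<Longrightarrow> dim_col A = n \<Longrightarrow> A + 0\<^sub>m m n = (A :: 'a::monoid_add mat)"
  by (auto intro: right_add_zero_mat)

lemma one_smult_mat: "1 \<cdot>\<^sub>m A = (A :: 'a::monoid_mult mat)"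
  by auto

lemma smult_smult_mat: "c \<cdot>\<^sub>m (d \<cdot>\<^sub>m A) = (c * d) \<cdot>\<^sub>m (A :: 'a::semigroup_mult mat)"
  by (auto simp: mult.assoc)

lemma four_block_mult_dim:
  fixes A1 A2 :: "'a::semiring_0 mat"
  shows "dim_row B1 = dim_row A1 \<Longrightarrow> dim_row D1 = dim_row C1 \<Longrightarrow>
    dim_col C1 = dim_col A1 \<Longrightarrow> dim_col D1 = dim_col B1 \<Longrightarrow>
    dim_row A2 = dim_col A1 \<Longrightarrow> dim_row B2 = dim_row A2 \<Longrightarrow>
    dim_row C2 = dim_col D1 \<Longrightarrow> dim_row D2 = dim_row C2 \<Longrightarrow>
    dim_col C2 = dim_col A2 \<Longrightarrow> dim_col D2 = dim_col B2 \<Longrightarrow>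
    four_block_mat A1 B1 C1 D1 * four_block_mat A2 B2 C2 D2 =
    four_block_mat (A1 * A2 + B1 * C2) (A1 * B2 + B1 * D2) (C1 * A2 + D1 * C2) (C1 * B2 + D1 * D2)"
  by (rule mult_four_block_mat[of A1 "dim_row A1" "dim_col A1" B1 "dim_col B1" C1 "dim_row C1" D1 A2
        "dim_col A2" B2 "dim_col B2"]) auto

lemma four_block_inject:
  assumes eq: "four_block_mat A B C D = four_block_mat A' B' C' D'"
    and "dim_row A = a" "dim_col A = c" "dim_row B = a" "dim_col B = d"
    "dim_row C = b" "dim_col C = c" "dim_row D = b" "dim_col D = d"
    and "dim_row A' = a" "dim_col A' = c" "dim_row B' = a" "dim_col B' = d"
    "dim_row C' = b" "dim_col C' = c" "dim_row D' = b" "dim_col D' = d"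
  shows "A = A'" "B = B'" "C = C'" "D = D'"
proof -
  have ix: "four_block_mat A B C D $$ (i, j) = four_block_mat A' B' C' D' $$ (i, j)" for i j
    by (simp add: eq)
  show "A = A'"
  proof (rule eq_matI)
    fix i j assume "i < dim_row A'" "j < dim_col A'"
    then show "A $$ (i, j) = A' $$ (i, j)" using ix[of i j] assms(2-) by simp
  qed (use assms(2-) in simp_all)
  show "B = B'"
  proof (rule eq_matI)
    fix i j assume "i < dim_row B'" "j < dim_col B'"
    then show "B $$ (i, j) = B' $$ (i, j)" using ix[of i "j + c"] assms(2-) by simp
  qed (use assms(2-) in simp_all)
  show "C = C'"
  proof (rule eq_matI)
    fix i j assume "i < dim_row C'" "j < dim_col C'"
    then show "C $$ (i, j) = C' $$ (i, j)" using ix[of "i + a" j] assms(2-) by simp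
  qed (use assms(2-) in simp_all)
  show "D = D'"
  proof (rule eq_matI)
    fix i j assume "i < dim_row D'" "j < dim_col D'"
    then show "D $$ (i, j) = D' $$ (i, j)" using ix[of "i + a" "j + c"] assms(2-) by simp
  qed (use assms(2-) in simp_all)
qed

lemma four_block_exists:
  assumes "A \<in> carrier_mat (a + b) (c + d)"
  obtains A1 A2 A3 A4 where "A = four_block_mat A1 A2 A3 A4"
    "A1 \<in> carrier_mat a c" "A2 \<in> carrier_mat a d" "A3 \<in> carrier_mat b c" "A4 \<in> carrier_mat b d"
proof -
  obtain A1 A2 A3 A4 where s: "split_block A a c = (A1, A2, A3, A4)"
    by (metis prod_cases4)
  show thesis
    using split_block[OF s, of b d] assms that by auto
qed

lemma dim_cadj [simp]: "dim_row (cadj A) = dim_col A" "dim_col (cadj A) = dim_row A"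
  by (simp_all add: cadj_def)

lemma index_cadj [simp]: "i < dim_col A \<Longrightarrow> j < dim_row A \<Longrightarrow> cadj A $$ (i, j) = cnj (A $$ (j, i))"
  by (simp add: cadj_def)

lemma cadj_carrier [simp]: "A \<in> carrier_mat m n \<Longrightarrow> cadj A \<in> carrier_mat n m"
  by (simp add: cadj_def)

lemma cadj_cadj [simp]: "cadj (cadj A) = A"
  by (rule eq_matI) auto

lemma cadj_one [simp]: "cadj (1\<^sub>m n) = 1\<^sub>m n"
  by (rule eq_matI) auto

lemma cadj_zero [simp]: "cadj (0\<^sub>m m n) = 0\<^sub>m n m"
  by (rule eq_matI) auto

lemma cadj_smult: "cadj (c \<cdot>\<^sub>m A) = cnj c \<cdot>\<^sub>m cadj A"
  by (rule eq_matI) auto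

lemma cadj_add: "dim_row A = dim_row B \<Longrightarrow> dim_col A = dim_col B \<Longrightarrow> cadj (A + B) = cadj A + cadj B"
  by (rule eq_matI) auto

lemma cadj_mult: "dim_col A = dim_row B \<Longrightarrow> cadj (A * B) = cadj B * cadj A"
  by (rule eq_matI) (auto simp: scalar_prod_def mult.commute)

lemma cadj_four_block:
  "dim_row B = dim_row A \<Longrightarrow> dim_col B = dim_col D \<Longrightarrow> dim_row C = dim_row D \<Longrightarrow> dim_col C = dim_col A \<Longrightarrow>
   cadj (four_block_mat A B C D) = four_block_mat (cadj A) (cadj C) (cadj B) (cadj D)"
  by (rule eq_matI) auto

text \<open>Dimension equations as side conditions, in place of carriers with free size parameters,
  let the simplifier discharge them. Products are normalised to right-nested form.\<close>

lemmas mat_dim_simps =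
  mult_assoc_dim mult_add_dim add_mult_dim smult_mult_dim mult_smult_dim
  zero_add_dim add_zero_dim one_smult_mat smult_smult_mat
  four_block_mult_dim cadj_smult cadj_add cadj_mult cadj_four_block

text \<open>A one-sided inverse of a square matrix is two-sided. The last two facts cancel a factor
  inside the right-nested products that \<open>mat_dim_simps\<close> produces.\<close>

lemma unitary_matD:
  assumes "unitary_mat n U"
  shows "dim_row U = n" "dim_col U = n" "cadj U * U = 1\<^sub>m n" "U * cadj U = 1\<^sub>m n"
    "dim_row X = n \<Longrightarrow> cadj U * (U * X) = X" "dim_row X = n \<Longrightarrow> U * (cadj U * X) = X"
proof -
  have U: "U \<in> carrier_mat n n" and UU: "cadj U * U = 1\<^sub>m n"
    using assms by (auto simp: unitary_mat_def)
  have UU': "U * cadj U = 1\<^sub>m n"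
    by (rule mat_mult_left_right_inverse[OF cadj_carrier[OF U] U UU])
  show "dim_row U = n" "dim_col U = n" "cadj U * U = 1\<^sub>m n" "U * cadj U = 1\<^sub>m n"
    using U UU UU' by auto
  assume X: "dim_row X = n"
  have "cadj U * (U * X) = (cadj U * U) * X" "U * (cadj U * X) = (U * cadj U) * X"
    using U X by (simp_all add: mult_assoc_dim)
  then show "cadj U * (U * X) = X" "U * (cadj U * X) = X"
    using X by (simp_all add: UU UU')
qed

lemma unitary_matI: "dim_row U = n \<Longrightarrow> dim_col U = n \<Longrightarrow> cadj U * U = 1\<^sub>m n \<Longrightarrow> unitary_mat n U"
  by (auto simp: unitary_mat_def)

lemma unitary_mat_carrier: "unitary_mat n U \<Longrightarrow> U \<in> carrier_mat n n"
  by (simp add: unitary_mat_def)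

lemma unitary_one [simp]: "unitary_mat n (1\<^sub>m n)"
  by (simp add: unitary_mat_def)

lemma unitary_cadj: "unitary_mat n U \<Longrightarrow> unitary_mat n (cadj U)"
  by (rule unitary_matI) (simp_all add: unitary_matD)

lemma unitary_mult:
  assumes "unitary_mat n U" "unitary_mat n V"
  shows "unitary_mat n (U * V)"
  by (rule unitary_matI) (simp_all add: unitary_matD[OF assms(1)] unitary_matD[OF assms(2)] mat_dim_simps)

lemma unitary_smult:
  assumes "unitary_mat n U" "cmod c = 1"
  shows "unitary_mat n (c \<cdot>\<^sub>m U)"
proof (rule unitary_matI)
  have "c * cnj c = 1"
    using assms(2) by (metis complex_norm_square of_real_1 one_power2)
  then show "cadj (c \<cdot>\<^sub>m U) * (c \<cdot>\<^sub>m U) = 1\<^sub>m n"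
    by (simp add: unitary_matD[OF assms(1)] mat_dim_simps)
qed (simp_all add: unitary_matD[OF assms(1)])

lemma unitary_four_block_diag:
  assumes "unitary_mat m U" "unitary_mat n V"
  shows "unitary_mat (m + n) (four_block_mat U (0\<^sub>m m n) (0\<^sub>m n m) V)"
  by (rule unitary_matI)
     (simp_all add: unitary_matD[OF assms(1)] unitary_matD[OF assms(2)] mat_dim_simps)

text \<open>Block swaps with phases: they exchange the two halves of a design and adjust the
  signs.\<close>

lemma unitary_four_block_antidiag:
  assumes "cmod c = 1" "cmod d = 1"
  shows "unitary_mat (n + n) (four_block_mat (0\<^sub>m n n) (c \<cdot>\<^sub>m 1\<^sub>m n) (d \<cdot>\<^sub>m 1\<^sub>m n) (0\<^sub>m n n))"
proof (rule unitary_matI)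
  have "c * cnj c = 1" "d * cnj d = 1"
    using assms by (metis complex_norm_square of_real_1 one_power2)+
  then show "cadj (four_block_mat (0\<^sub>m n n) (c \<cdot>\<^sub>m 1\<^sub>m n) (d \<cdot>\<^sub>m 1\<^sub>m n) (0\<^sub>m n n)) *
      four_block_mat (0\<^sub>m n n) (c \<cdot>\<^sub>m 1\<^sub>m n) (d \<cdot>\<^sub>m 1\<^sub>m n) (0\<^sub>m n n) = 1\<^sub>m (n + n)"
    by (simp add: mat_dim_simps)
qed simp_all

section \<open>Equivalence of matrix families\<close>

definition unitarily_equiv ::
    "nat \<Rightarrow> ('z \<Rightarrow> complex mat) \<Rightarrow> ('z \<Rightarrow> complex mat) \<Rightarrow> bool" where
  "unitarily_equiv n F G \<longleftrightarrow>
     (\<exists>U V. unitary_mat n U \<and> unitary_mat n V \<and> (\<forall>z. F z = U * G z * V))"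

lemma unitarily_equivI:
  "unitary_mat n U \<Longrightarrow> unitary_mat n V \<Longrightarrow> (\<And>z. F z = U * G z * V) \<Longrightarrow> unitarily_equiv n F G"
  by (auto simp: unitarily_equiv_def)

lemma unitarily_equivE:
  assumes "unitarily_equiv n F G"
  obtains U V where "unitary_mat n U" "unitary_mat n V" "\<And>z. F z = U * G z * V"
  using assms unfolding unitarily_equiv_def by blast

lemma unitarily_equiv_refl: "(\<And>z. F z \<in> carrier_mat n n) \<Longrightarrow> unitarily_equiv n F F"
proof (rule unitarily_equivI[of n "1\<^sub>m n" "1\<^sub>m n"])
  fix z assume "\<And>z. F z \<in> carrier_mat n n"
  then have "dim_row (F z) = n" "dim_col (F z) = n"
    by auto
  then show "F z = 1\<^sub>m n * F z * 1\<^sub>m n"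
    by simp
qed simp_all

lemma unitarily_equiv_sym:
  assumes "unitarily_equiv n F G" "\<And>z. G z \<in> carrier_mat n n"
  shows "unitarily_equiv n G F"
proof -
  obtain U V where UV: "unitary_mat n U" "unitary_mat n V" "\<And>z. F z = U * G z * V"
    using unitarily_equivE[OF assms(1)] by blast
  note d = unitary_matD[OF UV(1)] unitary_matD[OF UV(2)]
  have "dim_row (G z) = n" "dim_col (G z) = n" for z
    using assms(2)[of z] by auto
  then show ?thesis
    by (intro unitarily_equivI[of n "cadj U" "cadj V"])
       (simp_all add: UV(3) unitary_cadj[OF UV(1)] unitary_cadj[OF UV(2)] d mat_dim_simps)
qed

lemma unitarily_equiv_trans:
  assumes "unitarily_equiv n F G" "unitarily_equiv n G H" "\<And>z. H z \<in> carrier_mat n n"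
  shows "unitarily_equiv n F H"
proof -
  obtain U V where UV: "unitary_mat n U" "unitary_mat n V" "\<And>z. F z = U * G z * V"
    using unitarily_equivE[OF assms(1)] by blast
  obtain U' V' where UV': "unitary_mat n U'" "unitary_mat n V'" "\<And>z. G z = U' * H z * V'"
    using unitarily_equivE[OF assms(2)] by blast
  note d = unitary_matD[OF UV(1)] unitary_matD[OF UV(2)] unitary_matD[OF UV'(1)] unitary_matD[OF UV'(2)]
  have "dim_row (H z) = n" "dim_col (H z) = n" for z
    using assms(3)[of z] by auto
  then show ?thesis
    by (intro unitarily_equivI[of n "U * U'" "V' * V"])
       (simp_all add: UV(3) UV'(3) unitary_mult[OF UV(1) UV'(1)] unitary_mult[OF UV'(2) UV(2)]
          d mat_dim_simps)
qed

section \<open>Direct sums and the extension step\<close>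

text \<open>The matrix P depends on \<open>\<sigma>\<close> alone and serves all pairs A, B at once;
  equivalence of families requires this uniformity.\<close>

lemma permutation_conjugation:
  assumes bij: "bij_betw \<sigma> {..<n} {..<n}"
  obtains P where "unitary_mat n P"
    "\<And>A B. A \<in> carrier_mat n n \<Longrightarrow> B \<in> carrier_mat n n \<Longrightarrow>
       (\<And>i j. i < n \<Longrightarrow> j < n \<Longrightarrow> B $$ (i, j) = A $$ (\<sigma> i, \<sigma> j)) \<Longrightarrow> B = P * A * cadj P"
proof -
  define P :: "complex mat" where "P = mat n n (\<lambda>(i, j). if j = \<sigma> i then 1 else 0)"
  have dims [simp]: "dim_row P = n" "dim_col P = n"
    by (simp_all add: P_def)
  have \<sigma>: "\<sigma> i < n" if "i < n" for i
    using bij that by (auto simp: bij_betw_def)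
  have inj: "\<sigma> i = \<sigma> j \<longleftrightarrow> i = j" if "i < n" "j < n" for i j
    using bij that by (auto simp: bij_betw_def inj_on_def)
  have mult: "(P * A * cadj P) $$ (i, j) = A $$ (\<sigma> i, \<sigma> j)"
    if "A \<in> carrier_mat n n" "i < n" "j < n" for A i j
  proof -
    have "(P * A) $$ (i, l) = A $$ (\<sigma> i, l)" if "l < n" for l
      using that \<open>i < n\<close> \<open>A \<in> carrier_mat n n\<close> \<sigma>[OF \<open>i < n\<close>]
      by (simp add: P_def scalar_prod_def of_bool_def if_distrib[of "\<lambda>x. x * _"] cong: if_cong)
    then have "(P * A * cadj P) $$ (i, j) = (\<Sum>l<n. A $$ (\<sigma> i, l) * (if l = \<sigma> j then 1 else 0))"
      using that by (auto simp: scalar_prod_def P_def atLeast0LessThan intro!: sum.cong)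
    also have "\<dots> = A $$ (\<sigma> i, \<sigma> j)"
      using \<sigma>[OF \<open>j < n\<close>] by (simp add: if_distrib cong: if_cong)
    finally show ?thesis .
  qed
  \<comment> \<open>The entry formula \<open>mult\<close>, applied to the identity matrix, already
    gives unitarity, because \<open>\<sigma>\<close> is injective.\<close>
  have "P * cadj P = P * 1\<^sub>m n * cadj P"
    by simp
  also have "\<dots> = 1\<^sub>m n"
    by (rule eq_matI) (simp_all add: mult \<sigma> inj del: right_mult_one_mat' index_mult_mat(1))
  finally have "unitary_mat n (cadj P)"
    by (intro unitary_matI) simp_all
  then have "unitary_mat n P"
    using unitary_cadj by fastforce
  moreover have "B = P * A * cadj P"
    if "A \<in> carrier_mat n n" "B \<in> carrier_mat n n"
      "\<And>i j. i < n \<Longrightarrow> j < n \<Longrightarrow> B $$ (i, j) = A $$ (\<sigma> i, \<sigma> j)" for A B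
    by (rule eq_matI) (use that mult in auto)
  ultimately show thesis
    using that by blast
qed

definition dsum_mat :: "complex mat \<Rightarrow> complex mat \<Rightarrow> complex mat" where
  "dsum_mat A B = four_block_mat A (0\<^sub>m (dim_row A) (dim_col B)) (0\<^sub>m (dim_row B) (dim_col A)) B"

lemma diag_block_mat_Cons: "diag_block_mat (A # As) = dsum_mat A (diag_block_mat As)"
  by (simp add: dsum_mat_def Let_def)

lemma dsum_carrier [simp]:
  "A \<in> carrier_mat m m \<Longrightarrow> B \<in> carrier_mat n n \<Longrightarrow> dsum_mat A B \<in> carrier_mat (m + n) (m + n)"
  by (auto simp: dsum_mat_def)

lemma dim_dsum [simp]:
  "dim_row (dsum_mat A B) = dim_row A + dim_row B" "dim_col (dsum_mat A B) = dim_col A + dim_col B"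
  by (simp_all add: dsum_mat_def)

lemma dsum_mult:
  "dim_col A = dim_row C \<Longrightarrow> dim_col B = dim_row D \<Longrightarrow> dsum_mat A B * dsum_mat C D = dsum_mat (A * C) (B * D)"
  by (simp add: dsum_mat_def mat_dim_simps)

lemma unitary_dsum: "unitary_mat m U \<Longrightarrow> unitary_mat n V \<Longrightarrow> unitary_mat (m + n) (dsum_mat U V)"
  using unitary_four_block_diag by (simp add: dsum_mat_def unitary_matD)

lemma unitarily_equiv_dsum:
  assumes "unitarily_equiv m F F'" "unitarily_equiv n G G'"
    and "\<And>z. F' z \<in> carrier_mat m m" "\<And>z. G' z \<in> carrier_mat n n"
  shows "unitarily_equiv (m + n) (\<lambda>z. dsum_mat (F z) (G z)) (\<lambda>z. dsum_mat (F' z) (G' z))"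
proof -
  obtain U V where UV: "unitary_mat m U" "unitary_mat m V" "\<And>z. F z = U * F' z * V"
    using unitarily_equivE[OF assms(1)] by blast
  obtain U' V' where UV': "unitary_mat n U'" "unitary_mat n V'" "\<And>z. G z = U' * G' z * V'"
    using unitarily_equivE[OF assms(2)] by blast
  note d = unitary_matD(1,2)[OF UV(1)] unitary_matD(1,2)[OF UV(2)]
    unitary_matD(1,2)[OF UV'(1)] unitary_matD(1,2)[OF UV'(2)]
  have "dim_row (F' z) = m" "dim_col (F' z) = m" "dim_row (G' z) = n" "dim_col (G' z) = n" for z
    using assms(3)[of z] assms(4)[of z] by auto
  then show ?thesis
    by (intro unitarily_equivI[OF unitary_dsum[OF UV(1) UV'(1)] unitary_dsum[OF UV(2) UV'(2)]])
       (simp add: dsum_mult UV(3) UV'(3) d)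
qed

lemma diag_block_mat_carrier:
  fixes As :: "complex mat list"
  shows "(\<And>A. A \<in> set As \<Longrightarrow> A \<in> carrier_mat d d) \<Longrightarrow>
   diag_block_mat As \<in> carrier_mat (length As * d) (length As * d)"
  by (induction As) (simp_all add: diag_block_mat_Cons del: diag_block_mat.simps(2))

lemma unitarily_equiv_diag_block_mat:
  assumes "list_all2 (unitarily_equiv d) Fs Gs" "\<And>G z. G \<in> set Gs \<Longrightarrow> G z \<in> carrier_mat d d"
  shows "unitarily_equiv (length Gs * d)
    (\<lambda>z. diag_block_mat (map (\<lambda>F. F z) Fs)) (\<lambda>z. diag_block_mat (map (\<lambda>G. G z) Gs))"
  using assms
proof (induction Fs Gs rule: list_all2_induct)
  case Nil
  then show ?case by (simp add: unitarily_equiv_refl)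
next
  case (Cons F Fs G Gs)
  have "diag_block_mat (map (\<lambda>G. G z) Gs) \<in> carrier_mat (length Gs * d) (length Gs * d)" for z
    using diag_block_mat_carrier[of "map (\<lambda>G. G z) Gs" d] Cons.prems by auto
  with Cons show ?case
    using unitarily_equiv_dsum[of d F G "length Gs * d"]
    by (simp add: diag_block_mat_Cons del: diag_block_mat.simps(2))
qed

section \<open>The extension step and its compatibility with equivalence and direct sums\<close>

text \<open>The recursive step of \<open>Cdes\<close>, with the value w of the new variable as a
  separate argument, so that \<open>cnj w\<close> can be passed to obtain
  \<open>Cdes_minus\<close>.\<close>

definition design_ext :: "complex \<Rightarrow> complex mat \<Rightarrow> complex mat" where
  "design_ext w A = four_block_mat A (w \<cdot>\<^sub>m 1\<^sub>m (dim_row A)) ((- cnj w) \<cdot>\<^sub>m 1\<^sub>m (dim_row A)) (cadj A)"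

lemma design_ext_carrier [simp]: "A \<in> carrier_mat n n \<Longrightarrow> design_ext w A \<in> carrier_mat (n + n) (n + n)"
  by (auto simp: design_ext_def)

lemma dim_design_ext [simp]:
  "dim_row (design_ext w A) = dim_row A + dim_col A" "dim_col (design_ext w A) = dim_col A + dim_row A"
  by (simp_all add: design_ext_def)

text \<open>With outer factors diag(U, V^H) and diag(V, U^H) the scalar blocks meet U U^H and V^H V,
  which are both 1, and the lower right block becomes V^H A^H U^H, the adjoint of U A V.\<close>

lemma design_ext_mult:
  assumes "unitary_mat n U" "unitary_mat n V" "A \<in> carrier_mat n n"
  shows "design_ext w (U * A * V) = dsum_mat U (cadj V) * design_ext w A * dsum_mat V (cadj U)"
proof -
  have "dim_row A = n" "dim_col A = n"
    using assms(3) by auto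
  then show ?thesis
    using unitary_matD[OF assms(1)] unitary_matD[OF assms(2)]
    by (simp add: dsum_mat_def design_ext_def mat_dim_simps)
qed

lemma unitarily_equiv_design_ext:
  assumes "unitarily_equiv n F G" "\<And>z. G z \<in> carrier_mat n n"
  shows "unitarily_equiv (n + n) (\<lambda>z. design_ext (w z) (F z)) (\<lambda>z. design_ext (w z) (G z))"
proof -
  obtain U V where UV: "unitary_mat n U" "unitary_mat n V" "\<And>z. F z = U * G z * V"
    using unitarily_equivE[OF assms(1)] by blast
  show ?thesis
    by (rule unitarily_equivI[OF unitary_dsum[OF UV(1) unitary_cadj[OF UV(2)]]
          unitary_dsum[OF UV(2) unitary_cadj[OF UV(1)]]])
       (simp add: UV(3) design_ext_mult[OF UV(1,2) assms(2)])
qed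

text \<open>Extending a sum orders the diagonal blocks as A, B, A^H, B^H; summing extensions orders
  them as A, A^H, B, B^H. A reordering that depends only on the sizes relates the two, so P is the
  same for all w, A and B.\<close>

lemma design_ext_dsum:
  obtains P where "unitary_mat ((a + a) + (b + b)) P"
    "\<And>w A B. A \<in> carrier_mat a a \<Longrightarrow> B \<in> carrier_mat b b \<Longrightarrow>
       design_ext w (dsum_mat A B) = P * dsum_mat (design_ext w A) (design_ext w B) * cadj P"
proof -
  \<comment> \<open>exchanges the two middle blocks, of sizes \<open>b\<close> and \<open>a\<close>\<close>
  define \<sigma> where "\<sigma> i = (if i < a then i else if i < a + b then i + a else if i < a + b + a then i - b else i)"
    for i
  let ?n = "(a + a) + (b + b)"
  have "bij_betw \<sigma> {..<?n} {..<?n}"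
    by (rule bij_betwI[where g = "\<lambda>i. if i < a then i else if i < a + a then i + b
          else if i < a + a + b then i - a else i"]) (auto simp: \<sigma>_def)
  then obtain P where P: "unitary_mat ?n P"
    "\<And>A B. A \<in> carrier_mat ?n ?n \<Longrightarrow> B \<in> carrier_mat ?n ?n \<Longrightarrow>
       (\<And>i j. i < ?n \<Longrightarrow> j < ?n \<Longrightarrow> B $$ (i, j) = A $$ (\<sigma> i, \<sigma> j)) \<Longrightarrow> B = P * A * cadj P"
    using permutation_conjugation by blast
  have "design_ext w (dsum_mat A B) = P * dsum_mat (design_ext w A) (design_ext w B) * cadj P"
    if "A \<in> carrier_mat a a" "B \<in> carrier_mat b b" for w A B
  proof (rule P(2))
    have dims: "dim_row A = a" "dim_col A = a" "dim_row B = b" "dim_col B = b"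
      using that by auto
    \<comment> \<open>Each index is a block offset plus a remainder; the entry equation then splits
      into sixteen cases, one for each pair of blocks.\<close>
    have quarter: "(\<exists>l<a. i = l) \<or> (\<exists>l<b. i = a + l) \<or> (\<exists>l<a. i = a + b + l) \<or> (\<exists>l<b. i = a + b + a + l)"
      if "i < ?n" for i
      using that by presburger
    fix i j assume "i < ?n" "j < ?n"
    from quarter[OF this(1)] quarter[OF this(2)] show "design_ext w (dsum_mat A B) $$ (i, j) = dsum_mat (design_ext w A) (design_ext w B) $$ (\<sigma> i, \<sigma> j)"
      by (elim disjE exE conjE; simp add: \<sigma>_def design_ext_def dsum_mat_def dims)
  qed (use that in \<open>auto simp: ac_simps\<close>)
  then show thesis
    using that P(1) by blast
qed

lemma unitarily_equiv_design_ext_dsum: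
  assumes "\<And>z. F z \<in> carrier_mat a a" "\<And>z. G z \<in> carrier_mat b b"
  shows "unitarily_equiv ((a + b) + (a + b)) (\<lambda>z. design_ext (w z) (dsum_mat (F z) (G z)))
    (\<lambda>z. dsum_mat (design_ext (w z) (F z)) (design_ext (w z) (G z)))"
proof -
  obtain P where P: "unitary_mat ((a + a) + (b + b)) P"
    "\<And>w A B. A \<in> carrier_mat a a \<Longrightarrow> B \<in> carrier_mat b b \<Longrightarrow>
       design_ext w (dsum_mat A B) = P * dsum_mat (design_ext w A) (design_ext w B) * cadj P"
    by (rule design_ext_dsum[of a b]) blast
  have eq: "(a + b) + (a + b) = (a + a) + (b + b)"
    by simp
  show ?thesis
    unfolding eq by (rule unitarily_equivI[OF P(1) unitary_cadj[OF P(1)]]) (rule P(2)[OF assms])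
qed

lemma unitarily_equiv_design_ext_diag_block_mat:
  assumes "\<And>F z. F \<in> set Fs \<Longrightarrow> F z \<in> carrier_mat d d"
  shows "unitarily_equiv (length Fs * (d + d)) (\<lambda>z. design_ext (w z) (diag_block_mat (map (\<lambda>F. F z) Fs)))
    (\<lambda>z. diag_block_mat (map (\<lambda>F. design_ext (w z) (F z)) Fs))"
  using assms
proof (induction Fs)
  case Nil
  have "design_ext c (0\<^sub>m 0 0) = 0\<^sub>m 0 0" for c
    by (rule eq_matI) (auto simp: design_ext_def)
  then show ?case by (simp add: unitarily_equiv_refl)
next
  case (Cons F Fs)
  let ?n = "length Fs * d"
  have 1: "diag_block_mat (map (\<lambda>F. F z) Fs) \<in> carrier_mat ?n ?n" for z
    using diag_block_mat_carrier[of "map (\<lambda>F. F z) Fs" d] Cons.prems by auto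
  have 2: "diag_block_mat (map (\<lambda>F. design_ext (w z) (F z)) Fs) \<in>
      carrier_mat (length Fs * (d + d)) (length Fs * (d + d))" for z
  proof -
    have "design_ext (w z) (F z) \<in> carrier_mat (d + d) (d + d)" if "F \<in> set Fs" for F
      by (rule design_ext_carrier) (use Cons.prems that in auto)
    then show ?thesis
      using diag_block_mat_carrier[of "map (\<lambda>F. design_ext (w z) (F z)) Fs" "d + d"] by auto
  qed
  have F: "F z \<in> carrier_mat d d" for z
    using Cons.prems by auto
  have 3: "unitarily_equiv ((d + ?n) + (d + ?n))
      (\<lambda>z. design_ext (w z) (dsum_mat (F z) (diag_block_mat (map (\<lambda>F. F z) Fs))))
      (\<lambda>z. dsum_mat (design_ext (w z) (F z)) (design_ext (w z) (diag_block_mat (map (\<lambda>F. F z) Fs))))"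
    by (rule unitarily_equiv_design_ext_dsum) (fact F 1)+
  have 4: "unitarily_equiv ((d + d) + length Fs * (d + d))
      (\<lambda>z. dsum_mat (design_ext (w z) (F z)) (design_ext (w z) (diag_block_mat (map (\<lambda>F. F z) Fs))))
      (\<lambda>z. dsum_mat (design_ext (w z) (F z)) (diag_block_mat (map (\<lambda>F. design_ext (w z) (F z)) Fs)))"
    by (intro unitarily_equiv_dsum unitarily_equiv_refl Cons.IH) (use Cons.prems 2 F in auto)
  have eq: "(d + ?n) + (d + ?n) = (d + d) + length Fs * (d + d)"
    by (simp add: algebra_simps)
  have "unitarily_equiv ((d + d) + length Fs * (d + d))
      (\<lambda>z. design_ext (w z) (dsum_mat (F z) (diag_block_mat (map (\<lambda>F. F z) Fs))))
      (\<lambda>z. dsum_mat (design_ext (w z) (F z)) (diag_block_mat (map (\<lambda>F. design_ext (w z) (F z)) Fs)))"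
    by (rule unitarily_equiv_trans[OF 3[unfolded eq] 4]) (use F 2 in simp)
  then show ?case
    by (simp add: diag_block_mat_Cons del: diag_block_mat.simps(2))
qed

text \<open>Exchanging the halves on both sides brings A^H to the front; the signs in the outer
  factors restore the pattern of the off-diagonal blocks, at the price of conjugating w. This is how
  a conjugation inside A moves to the new variable.\<close>

lemma design_ext_cadj_conjugation:
  assumes "A \<in> carrier_mat n n"
  shows "design_ext w A =
    four_block_mat (0\<^sub>m n n) (1 \<cdot>\<^sub>m 1\<^sub>m n) ((-1) \<cdot>\<^sub>m 1\<^sub>m n) (0\<^sub>m n n) * design_ext (cnj w) (cadj A) *
    four_block_mat (0\<^sub>m n n) ((-1) \<cdot>\<^sub>m 1\<^sub>m n) (1 \<cdot>\<^sub>m 1\<^sub>m n) (0\<^sub>m n n)"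
proof -
  have "dim_row A = n" "dim_col A = n"
    using assms by auto
  then show ?thesis
    by (simp add: design_ext_def mat_dim_simps)
qed

text \<open>Taking the adjoint has already moved the minus sign to the other off-diagonal block, so
  a plain swap of the halves is enough.\<close>

lemma cadj_design_ext:
  assumes "A \<in> carrier_mat n n"
  shows "cadj (design_ext w A) =
    four_block_mat (0\<^sub>m n n) (1 \<cdot>\<^sub>m 1\<^sub>m n) (1 \<cdot>\<^sub>m 1\<^sub>m n) (0\<^sub>m n n) * design_ext (cnj w) A *
    four_block_mat (0\<^sub>m n n) (1 \<cdot>\<^sub>m 1\<^sub>m n) (1 \<cdot>\<^sub>m 1\<^sub>m n) (0\<^sub>m n n)"
proof -
  have "dim_row A = n" "dim_col A = n"
    using assms by auto
  then show ?thesis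
    by (simp add: design_ext_def mat_dim_simps)
qed

lemma unitarily_equiv_design_ext_cadj:
  assumes "\<And>z. F z \<in> carrier_mat n n"
  shows "unitarily_equiv (n + n) (\<lambda>z. design_ext (w z) (F z)) (\<lambda>z. design_ext (cnj (w z)) (cadj (F z)))"
  by (rule unitarily_equivI[OF unitary_four_block_antidiag unitary_four_block_antidiag])
     (rule_tac [5] design_ext_cadj_conjugation[OF assms], simp_all)

lemma unitarily_equiv_cadj_design_ext:
  assumes "\<And>z. F z \<in> carrier_mat n n"
  shows "unitarily_equiv (n + n) (\<lambda>z. cadj (design_ext (w z) (F z))) (\<lambda>z. design_ext (cnj (w z)) (F z))"
  by (rule unitarily_equivI[OF unitary_four_block_antidiag unitary_four_block_antidiag])
     (rule_tac [5] cadj_design_ext[OF assms], simp_all)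

text \<open>Where F and G vanish, only the new variable is left, and comparing w with
  \<open>cnj w\<close> kills the off-diagonal blocks of U and of V^H. The diagonal blocks of a
  block-diagonal unitary are unitary, and setting the new variable to 0 leaves F W1 = U1 G in the
  upper left corner.\<close>

lemma unitarily_equiv_design_ext_cancel:
  assumes eq: "unitarily_equiv (n + n) (\<lambda>z. design_ext (z k) (F z)) (\<lambda>z. design_ext (z k) (G z))"
    and FG: "\<And>z. F z \<in> carrier_mat n n" "\<And>z. G z \<in> carrier_mat n n"
    and indep: "\<And>z w. F (z(k := w)) = F z" "\<And>z w. G (z(k := w)) = G z"
    and zero: "F (\<lambda>_. 0) = 0\<^sub>m n n" "G (\<lambda>_. 0) = 0\<^sub>m n n"
  shows "unitarily_equiv n F G"
proof -
  obtain U V where U: "unitary_mat (n + n) U" and V: "unitary_mat (n + n) V"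
    and UV: "\<And>z. design_ext (z k) (F z) = U * design_ext (z k) (G z) * V"
    using unitarily_equivE[OF eq] by blast
  obtain U1 U2 U3 U4 where U_eq: "U = four_block_mat U1 U2 U3 U4"
    and Uc: "U1 \<in> carrier_mat n n" "U2 \<in> carrier_mat n n" "U3 \<in> carrier_mat n n" "U4 \<in> carrier_mat n n"
    using unitary_mat_carrier[OF U] by (rule four_block_exists)
  define W where "W = cadj V"
  have W: "unitary_mat (n + n) W"
    unfolding W_def by (rule unitary_cadj[OF V])
  obtain W1 W2 W3 W4 where W_eq: "W = four_block_mat W1 W2 W3 W4"
    and Wc: "W1 \<in> carrier_mat n n" "W2 \<in> carrier_mat n n" "W3 \<in> carrier_mat n n" "W4 \<in> carrier_mat n n"
    using unitary_mat_carrier[OF W] by (rule four_block_exists)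
  have dG: "dim_row (G z) = n" "dim_col (G z) = n" and dF: "dim_row (F z) = n" "dim_col (F z) = n" for z
    using FG[of z] by auto
  note d = carrier_matD[OF Uc(1)] carrier_matD[OF Uc(2)] carrier_matD[OF Uc(3)] carrier_matD[OF Uc(4)]
    carrier_matD[OF Wc(1)] carrier_matD[OF Wc(2)] carrier_matD[OF Wc(3)] carrier_matD[OF Wc(4)] dF dG
  \<comment> \<open>With V moved to the left-hand side, the equation is linear in the blocks of U
    and W.\<close>
  have comm: "design_ext (z k) (F z) * W = U * design_ext (z k) (G z)" for z
    unfolding UV[of z] W_def
    by (simp add: mat_dim_simps unitary_matD[OF U] unitary_matD[OF V] dG)
  have blocks: "F z * W1 + z k \<cdot>\<^sub>m W3 = U1 * G z + (- cnj (z k)) \<cdot>\<^sub>m U2"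
    "F z * W2 + z k \<cdot>\<^sub>m W4 = z k \<cdot>\<^sub>m U1 + U2 * cadj (G z)"
    "(- cnj (z k)) \<cdot>\<^sub>m W1 + cadj (F z) * W3 = U3 * G z + (- cnj (z k)) \<cdot>\<^sub>m U4"
    "(- cnj (z k)) \<cdot>\<^sub>m W2 + cadj (F z) * W4 = z k \<cdot>\<^sub>m U3 + U4 * cadj (G z)" for z
  proof -
    have "four_block_mat (F z * W1 + z k \<cdot>\<^sub>m W3) (F z * W2 + z k \<cdot>\<^sub>m W4)
        ((- cnj (z k)) \<cdot>\<^sub>m W1 + cadj (F z) * W3) ((- cnj (z k)) \<cdot>\<^sub>m W2 + cadj (F z) * W4) =
      four_block_mat (U1 * G z + (- cnj (z k)) \<cdot>\<^sub>m U2) (z k \<cdot>\<^sub>m U1 + U2 * cadj (G z))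
        (U3 * G z + (- cnj (z k)) \<cdot>\<^sub>m U4) (z k \<cdot>\<^sub>m U3 + U4 * cadj (G z))"
      using comm[of z] unfolding U_eq W_eq by (simp add: design_ext_def mat_dim_simps d)
    from four_block_inject[OF this, of n n n n] show
      "F z * W1 + z k \<cdot>\<^sub>m W3 = U1 * G z + (- cnj (z k)) \<cdot>\<^sub>m U2"
      "F z * W2 + z k \<cdot>\<^sub>m W4 = z k \<cdot>\<^sub>m U1 + U2 * cadj (G z)"
      "(- cnj (z k)) \<cdot>\<^sub>m W1 + cadj (F z) * W3 = U3 * G z + (- cnj (z k)) \<cdot>\<^sub>m U4"
      "(- cnj (z k)) \<cdot>\<^sub>m W2 + cadj (F z) * W4 = z k \<cdot>\<^sub>m U3 + U4 * cadj (G z)"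
      by (simp_all add: d)
  qed
  \<comment> \<open>At the point whose only nonzero coordinate is the new one, \<open>indep\<close>
    and \<open>zero\<close> remove F and G.\<close>
  have at_axis: "w \<cdot>\<^sub>m W3 = (- cnj w) \<cdot>\<^sub>m U2" "(- cnj w) \<cdot>\<^sub>m W1 = (- cnj w) \<cdot>\<^sub>m U4"
    "(- cnj w) \<cdot>\<^sub>m W2 = w \<cdot>\<^sub>m U3" for w
    using blocks[of "(\<lambda>_. 0)(k := w)"] by (simp_all add: indep zero d mat_dim_simps)
  have entry: "w * W3 $$ (i, j) = - cnj w * U2 $$ (i, j)" "- cnj w * W1 $$ (i, j) = - cnj w * U4 $$ (i, j)"
    "- cnj w * W2 $$ (i, j) = w * U3 $$ (i, j)" if "i < n" "j < n" for i j w
    using arg_cong[OF at_axis(1)[of w], of "\<lambda>A. A $$ (i, j)"] arg_cong[OF at_axis(2)[of w], of "\<lambda>A. A $$ (i, j)"]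
      arg_cong[OF at_axis(3)[of w], of "\<lambda>A. A $$ (i, j)"] that by (simp_all add: d)
  \<comment> \<open>The value w = 1 gives W3 = - U2 and w = \<i> gives W3 = U2. The blocks U3 and W2
    are treated alike.\<close>
  have U2: "U2 = 0\<^sub>m n n"
  proof (rule eq_matI)
    fix i j assume "i < dim_row (0\<^sub>m n n)" "j < dim_col (0\<^sub>m n n)"
    then show "U2 $$ (i, j) = 0\<^sub>m n n $$ (i, j)"
      using entry(1)[of i j 1] entry(1)[of i j \<i>] by simp
  qed (simp_all add: d)
  have U3: "U3 = 0\<^sub>m n n"
  proof (rule eq_matI)
    fix i j assume "i < dim_row (0\<^sub>m n n)" "j < dim_col (0\<^sub>m n n)"
    then show "U3 $$ (i, j) = 0\<^sub>m n n $$ (i, j)"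
      using entry(3)[of i j 1] entry(3)[of i j \<i>] by simp
  qed (simp_all add: d)
  have W2: "W2 = 0\<^sub>m n n"
  proof (rule eq_matI)
    fix i j assume "i < dim_row (0\<^sub>m n n)" "j < dim_col (0\<^sub>m n n)"
    then show "W2 $$ (i, j) = 0\<^sub>m n n $$ (i, j)"
      using entry(3)[of i j 1] by (simp add: U3)
  qed (simp_all add: d)
  have W3: "W3 = 0\<^sub>m n n"
  proof (rule eq_matI)
    fix i j assume "i < dim_row (0\<^sub>m n n)" "j < dim_col (0\<^sub>m n n)"
    then show "W3 $$ (i, j) = 0\<^sub>m n n $$ (i, j)"
      using entry(1)[of i j 1] by (simp add: U2)
  qed (simp_all add: d)
  have diag: "unitary_mat n A" 
    if "unitary_mat (n + n) (four_block_mat A (0\<^sub>m n n) (0\<^sub>m n n) B)"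
      "A \<in> carrier_mat n n" "B \<in> carrier_mat n n" for A B
  proof -
    have "four_block_mat (cadj A * A) (0\<^sub>m n n) (0\<^sub>m n n) (cadj B * B) =
        four_block_mat (1\<^sub>m n) (0\<^sub>m n n) (0\<^sub>m n n) (1\<^sub>m n)"
      using unitary_matD(3)[OF that(1)] that(2,3) by (auto simp: mat_dim_simps)
    from four_block_inject(1)[OF this, of n n n n] have "cadj A * A = 1\<^sub>m n"
      using that(2,3) by auto
    then show ?thesis
      using that(2) by (auto intro: unitary_matI)
  qed
  have U1: "unitary_mat n U1"
    using U Uc unfolding U_eq U2 U3 by (intro diag[of U1 U4]) auto
  have W1: "unitary_mat n W1"
    using W Wc unfolding W_eq W2 W3 by (intro diag[of W1 W4]) auto
  show ?thesis
  proof (rule unitarily_equivI[OF U1 unitary_cadj[OF W1]])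
    fix z
    have "F z * W1 = U1 * G z"
      using blocks(1)[of "z(k := 0)"] by (simp add: indep W3 U2 d mat_dim_simps)
    then have "F z * W1 * cadj W1 = U1 * G z * cadj W1"
      by simp
    then show "F z = U1 * G z * cadj W1"
      by (simp add: mat_dim_simps d unitary_matD[OF W1])
  qed
qed

section \<open>Diagonalising Hermitian projections\<close>

definition diag_fun_mat :: "nat \<Rightarrow> (nat \<Rightarrow> complex) \<Rightarrow> complex mat" where
  "diag_fun_mat n \<delta> = mat n n (\<lambda>(i, j). if i = j then \<delta> i else 0)"

lemma dim_diag_fun_mat [simp]: "dim_row (diag_fun_mat n \<delta>) = n" "dim_col (diag_fun_mat n \<delta>) = n"
  by (simp_all add: diag_fun_mat_def)

lemma index_diag_fun_mat [simp]:
  "i < n \<Longrightarrow> j < n \<Longrightarrow> diag_fun_mat n \<delta> $$ (i, j) = (if i = j then \<delta> i else 0)"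
  by (simp add: diag_fun_mat_def)

lemma diag_fun_mat_carrier [simp]: "diag_fun_mat n \<delta> \<in> carrier_mat n n"
  by (simp add: diag_fun_mat_def)

lemma mult_diag_fun_mat:
  "dim_col A = n \<Longrightarrow> i < dim_row A \<Longrightarrow> j < n \<Longrightarrow> (A * diag_fun_mat n \<delta>) $$ (i, j) = A $$ (i, j) * \<delta> j"
  by (simp add: scalar_prod_def if_distrib cong: if_cong)

lemma diag_fun_mat_mult:
  "dim_row A = n \<Longrightarrow> i < n \<Longrightarrow> j < dim_col A \<Longrightarrow> (diag_fun_mat n \<delta> * A) $$ (i, j) = \<delta> i * A $$ (i, j)"
  by (simp add: scalar_prod_def if_distrib[of "\<lambda>x. x * _"] cong: if_cong)

lemma cadj_diag_fun_mat: "cadj (diag_fun_mat n \<delta>) = diag_fun_mat n (\<lambda>i. cnj (\<delta> i))"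
  by (rule eq_matI) auto

lemma unitary_col_norm:
  assumes "unitary_mat n U" "j < n"
  shows "(\<Sum>i<n. (cmod (U $$ (i, j)))\<^sup>2) = 1"
proof -
  have "(cadj U * U) $$ (j, j) = 1"
    using assms by (simp add: unitary_matD(3)[OF assms(1)])
  moreover have "(cadj U * U) $$ (j, j) = complex_of_real (\<Sum>i<n. (cmod (U $$ (i, j)))\<^sup>2)"
    using assms(2) unitary_matD(1,2)[OF assms(1)]
    by (simp add: scalar_prod_def complex_norm_square atLeast0LessThan mult.commute del: of_real_power)
  ultimately show ?thesis
    by (metis of_real_eq_1_iff)
qed

lemma unitary_row_norm:
  assumes "unitary_mat n U" "i < n"
  shows "(\<Sum>j<n. (cmod (U $$ (i, j)))\<^sup>2) = 1"
proof -
  have "(\<Sum>j<n. (cmod (cadj U $$ (j, i)))\<^sup>2) = 1"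
    by (rule unitary_col_norm[OF unitary_cadj[OF assms(1)] assms(2)])
  then show ?thesis
    using assms(2) unitary_matD(1,2)[OF assms(1)] by simp
qed

text \<open>Double counting of the squared moduli on I x J: the support condition puts the whole
  mass of the rows in I and of the columns in J there, and every row and every column has mass 1. It
  replaces rank arguments, both for the equal block sizes and for uniqueness in one
  variable.\<close>

lemma unitary_support_card:
  assumes U: "unitary_mat n U" and IJ: "I \<subseteq> {..<n}" "J \<subseteq> {..<n}"
    and supp: "\<And>i j. i < n \<Longrightarrow> j < n \<Longrightarrow> U $$ (i, j) \<noteq> 0 \<Longrightarrow> i \<in> I \<longleftrightarrow> j \<in> J"
  shows "card I = card J"
proof -
  let ?f = "\<lambda>i j. (cmod (U $$ (i, j)))\<^sup>2"
  have "real (card I) = (\<Sum>i\<in>I. \<Sum>j<n. ?f i j)"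
    using IJ unitary_row_norm[OF U] by (simp add: subset_iff)
  also have "\<dots> = (\<Sum>i\<in>I. \<Sum>j\<in>J. ?f i j)"
    by (intro sum.cong refl sum.mono_neutral_right) (use IJ supp in auto)
  also have "\<dots> = (\<Sum>j\<in>J. \<Sum>i\<in>I. ?f i j)"
    by (rule sum.swap)
  also have "\<dots> = (\<Sum>j\<in>J. \<Sum>i<n. ?f i j)"
    by (intro sum.cong refl sum.mono_neutral_left) (use IJ supp in auto)
  also have "\<dots> = real (card J)"
    using IJ unitary_col_norm[OF U] by (simp add: subset_iff)
  finally show ?thesis
    by simp
qed

text \<open>The unitary is a phase times the Householder reflection that exchanges \<open>v\<close> with a multiple of
  the first basis vector.\<close>

lemma unit_vector_completion:
  fixes v :: "nat \<Rightarrow> complex"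
  assumes n: "0 < n" and norm: "(\<Sum>i<n. (cmod (v i))\<^sup>2) = 1"
  obtains W where "unitary_mat n W" "\<And>i. i < n \<Longrightarrow> W $$ (i, 0) = v i"
proof -
  \<comment> \<open>The phase opposite to \<open>v 0\<close> avoids cancellation in
    \<open>w 0\<close>, so that the divisor q below is at least 1 even if v is already a basis
    vector; if \<open>v 0\<close> is 0, any phase would do. The value q is half the squared norm of
    w, which makes H the reflection I - 2 w w^H / (w^H w).\<close>
  define c where "c = (if v 0 = 0 then 1 else - sgn (v 0))"
  define q where "q = complex_of_real (1 + cmod (v 0))"
  define w where "w i = v i - (if i = 0 then c else 0)" for i
  define H where "H = mat n n (\<lambda>(i, j). (if i = j then 1 else 0) - w i * cnj (w j) / q)"
  have c: "cmod c = 1"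
    by (simp add: c_def norm_sgn)
  then have cc: "c * cnj c = 1"
    by (metis complex_norm_square of_real_1 one_power2)
  have v0: "v 0 = - c * cmod (v 0)"
    by (simp add: c_def sgn_eq)
  have w0: "w 0 = - c * q"
    by (subst w_def, subst v0) (simp add: q_def algebra_simps)
  have "1 + cmod (v 0) > 0"
    by (simp add: add_pos_nonneg)
  then have q0: "q \<noteq> 0"
    unfolding q_def by (metis less_irrefl of_real_eq_0_iff)
  have q_cnj: "cnj q = q"
    by (simp add: q_def)
  have split: "(\<Sum>i<n. f i) = f 0 + (\<Sum>i\<in>{1..<n}. f i)" for f :: "nat \<Rightarrow> complex"
    using n by (simp add: sum.atLeast_Suc_lessThan flip: atLeast0LessThan)
  have "(\<Sum>i<n. v i * cnj (v i)) = 1"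
    using arg_cong[OF norm, of complex_of_real] by (simp add: complex_norm_square del: of_real_power)
  then have tail: "(\<Sum>i\<in>{1..<n}. v i * cnj (v i)) = 1 - v 0 * cnj (v 0)"
    by (simp add: split eq_diff_eq add.commute)
  have "(\<Sum>i<n. w i * cnj (w i)) = w 0 * cnj (w 0) + (1 - v 0 * cnj (v 0))"
    unfolding split tail[symmetric] by (intro arg_cong2[of _ _ _ _ "(+)"] sum.cong) (auto simp: w_def)
  also have "w 0 * cnj (w 0) = (c * cnj c) * (q * q)"
    by (simp add: w0 q_cnj)
  also have "v 0 * cnj (v 0) = (q - 1) * (q - 1)"
    by (simp add: q_def flip: complex_norm_square power2_eq_square)
  finally have ww: "(\<Sum>i<n. w i * cnj (w i)) = 2 * q"
    by (simp add: cc algebra_simps)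
  have H_adj: "cadj H = H"
    by (rule eq_matI) (auto simp: H_def q_cnj)
  have "H * H = 1\<^sub>m n"
  proof (rule eq_matI)
    fix i j assume "i < dim_row (1\<^sub>m n)" "j < dim_col (1\<^sub>m n)"
    then have ij: "i < n" "j < n"
      by auto
    have "(H * H) $$ (i, j) = (\<Sum>l<n. ((if i = l then 1 else 0) - w i * cnj (w l) / q) *
        ((if l = j then 1 else 0) - w l * cnj (w j) / q))"
      using ij by (simp add: H_def scalar_prod_def atLeast0LessThan)
    also have "\<dots> = (\<Sum>l<n. (if i = l then (if l = j then 1 else 0) - w l * cnj (w j) / q else 0) -
        (if l = j then w i * cnj (w l) / q else 0) + w i * cnj (w j) / (q * q) * (w l * cnj (w l)))"
      by (rule sum.cong) (auto simp: algebra_simps)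
    also have "\<dots> = (if i = j then 1 else 0) - w i * cnj (w j) / q - w i * cnj (w j) / q +
        w i * cnj (w j) / (q * q) * (2 * q)"
      unfolding ww[symmetric] sum_distrib_left using ij by (simp add: sum.distrib sum_subtractf)
    also have "\<dots> = 1\<^sub>m n $$ (i, j)"
      using ij q0 by (simp add: field_simps)
    finally show "(H * H) $$ (i, j) = 1\<^sub>m n $$ (i, j)" .
  qed (simp_all add: H_def)
  then have "unitary_mat n H"
    by (intro unitary_matI) (simp_all add: H_adj, simp_all add: H_def)
  then have "unitary_mat n (c \<cdot>\<^sub>m H)"
    using c by (rule unitary_smult)
  \<comment> \<open>Since \<open>w 0\<close> is - c q, the first column of H is e_0 +
    \<open>cnj c\<close> w; times c this is c e_0 + w, which is v.\<close>
  moreover have "(c \<cdot>\<^sub>m H) $$ (i, 0) = v i" if "i < n" for i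
  proof -
    have "(c \<cdot>\<^sub>m H) $$ (i, 0) = (if i = 0 then c else 0) - w i * (c * cnj (w 0)) / q"
      using that n by (simp add: H_def algebra_simps)
    also have "c * cnj (w 0) = - ((c * cnj c) * q)"
      by (simp add: w0 q_cnj)
    finally show ?thesis
      using q0 by (simp add: cc w_def)
  qed
  ultimately show thesis
    using that by blast
qed

text \<open>A nonzero column of P is fixed by P, since P P = P. Completing it to a unitary basis
  splits off a 1 in the corner: the rest of the first column is 0, the first row follows because P
  is Hermitian, and the remaining block is a smaller projection. Each 1 is put in front and zeros
  arise only once the remainder is 0, so the ones come first.\<close>

lemma hermitian_projection_diagonal:
  assumes "P \<in> carrier_mat n n" "cadj P = P" "P * P = P"
  shows "\<exists>W r. unitary_mat n W \<and> r \<le> n \<and> P = W * diag_fun_mat n (\<lambda>i. if i < r then 1 else 0) * cadj W"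
  using assms
proof (induction n arbitrary: P)
  case 0
  then show ?case
    by (intro exI[of _ "1\<^sub>m 0"] exI[of _ 0]) (auto intro!: eq_matI)
next
  case (Suc n P)
  show ?case
  proof (cases "P = 0\<^sub>m (Suc n) (Suc n)")
    case True
    then show ?thesis
      by (intro exI[of _ "1\<^sub>m (Suc n)"] exI[of _ 0]) (auto intro!: eq_matI)
  next
    case False
    have dP: "dim_row P = Suc n" "dim_col P = Suc n"
      using Suc.prems(1) by auto
    obtain i0 j0 where ij: "i0 < Suc n" "j0 < Suc n" "P $$ (i0, j0) \<noteq> 0"
      using False dP by (metis eq_matI index_zero_mat)
    define s where "s = (\<Sum>i<Suc n. (cmod (P $$ (i, j0)))\<^sup>2)"
    \<comment> \<open>The nonzero column j0 of P, scaled to norm 1.\<close>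
    define v where "v i = P $$ (i, j0) / sqrt s" for i
    have "0 < s"
      unfolding s_def by (rule sum_pos2[of _ i0]) (use ij in auto)
    then have "(\<Sum>i<Suc n. (cmod (v i))\<^sup>2) = 1"
      by (simp add: v_def norm_divide power_divide s_def flip: sum_divide_distrib del: sum.lessThan_Suc)
    then obtain W where W: "unitary_mat (Suc n) W" "\<And>i. i < Suc n \<Longrightarrow> W $$ (i, 0) = v i"
      using unit_vector_completion[of "Suc n" v] by blast
    note dW = unitary_matD[OF W(1)]
    have Pv: "(P * W) $$ (i, 0) = W $$ (i, 0)" if "i < Suc n" for i
    proof -
      have "(P * W) $$ (i, 0) = (\<Sum>l<Suc n. P $$ (i, l) * P $$ (l, j0)) / sqrt s"
        using that by (simp add: scalar_prod_def dP dW W(2) v_def atLeast0LessThan sum_divide_distrib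
            del: sum.lessThan_Suc sum.op_ivl_Suc)
      also have "(\<Sum>l<Suc n. P $$ (i, l) * P $$ (l, j0)) = (P * P) $$ (i, j0)"
        using that ij by (simp add: scalar_prod_def dP atLeast0LessThan
            del: sum.lessThan_Suc sum.op_ivl_Suc)
      finally show ?thesis
        using that by (simp add: Suc.prems(3) W(2) v_def)
    qed
    define R where "R = cadj W * (P * W)"
    have dR: "dim_row R = Suc n" "dim_col R = Suc n"
      by (simp_all add: R_def dW)
    have R_adj: "cadj R = R" and R_idem: "R * R = R"
    proof -
      show "cadj R = R"
        by (simp add: R_def mat_dim_simps dW dP Suc.prems(2))
      have "R * R = cadj W * ((P * P) * W)"
        by (simp add: R_def mat_dim_simps dW dP)
      then show "R * R = R"
        by (simp add: Suc.prems(3) R_def)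
    qed
    have R_col: "R $$ (i, 0) = (if i = 0 then 1 else 0)" if "i < Suc n" for i
    proof -
      have "R $$ (i, 0) = (cadj W * W) $$ (i, 0)"
        unfolding R_def using that Pv by (simp add: scalar_prod_def dW(1,2) dP del: sum.op_ivl_Suc)
      then show ?thesis
        using that by (simp add: dW)
    qed
    have "R \<in> carrier_mat (1 + n) (1 + n)"
      using dR by auto
    then obtain R1 R2 R3 R4 where R_eq: "R = four_block_mat R1 R2 R3 R4"
      and Rc: "R1 \<in> carrier_mat 1 1" "R2 \<in> carrier_mat 1 n" "R3 \<in> carrier_mat n 1" "R4 \<in> carrier_mat n n"
      by (rule four_block_exists)
    note d = carrier_matD[OF Rc(1)] carrier_matD[OF Rc(2)] carrier_matD[OF Rc(3)] carrier_matD[OF Rc(4)]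
    have R1: "R1 = 1\<^sub>m 1"
      using R_col[of 0] unfolding R_eq by (intro eq_matI) (simp_all add: d)
    have R3: "R3 = 0\<^sub>m n 1"
    proof (rule eq_matI)
      fix i j assume "i < dim_row (0\<^sub>m n 1)" "j < dim_col (0\<^sub>m n 1)"
      then show "R3 $$ (i, j) = 0\<^sub>m n 1 $$ (i, j)"
        using R_col[of "Suc i"] unfolding R_eq by (simp add: d)
    qed (simp_all add: d)
    have "four_block_mat (cadj R1) (cadj R3) (cadj R2) (cadj R4) = four_block_mat R1 R2 R3 R4"
      using R_adj unfolding R_eq by (simp add: mat_dim_simps d)
    from four_block_inject(2,4)[OF this, of 1 1 n n] have R2: "R2 = 0\<^sub>m 1 n" and R4_adj: "cadj R4 = R4"
      by (simp_all add: d R3)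
    have "four_block_mat (1\<^sub>m 1) (0\<^sub>m 1 n) (0\<^sub>m n 1) (R4 * R4) = four_block_mat (1\<^sub>m 1) (0\<^sub>m 1 n) (0\<^sub>m n 1) R4"
      using R_idem unfolding R_eq R1 R2 R3 by (simp add: mat_dim_simps d)
    from four_block_inject(4)[OF this, of 1 1 n n] have "R4 * R4 = R4"
      by (simp add: d)
    from Suc.IH[OF Rc(4) R4_adj this] obtain W' r where W': "unitary_mat n W'" and r: "r \<le> n"
      and R4: "R4 = W' * diag_fun_mat n (\<lambda>i. if i < r then 1 else 0) * cadj W'"
      by blast
    note dW' = unitary_matD[OF W']
    define Q where "Q = four_block_mat (1\<^sub>m 1) (0\<^sub>m 1 n) (0\<^sub>m n 1) W'"
    have Q: "unitary_mat (Suc n) Q"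
      using unitary_four_block_diag[OF unitary_one[of 1] W'] by (simp add: Q_def)
    have diag: "diag_fun_mat (Suc n) (\<lambda>i. if i < Suc r then 1 else 0) =
        four_block_mat (1\<^sub>m 1) (0\<^sub>m 1 n) (0\<^sub>m n 1) (diag_fun_mat n (\<lambda>i. if i < r then 1 else 0))"
      by (rule eq_matI) auto
    have "R = Q * diag_fun_mat (Suc n) (\<lambda>i. if i < Suc r then 1 else 0) * cadj Q"
      unfolding diag R_eq R1 R2 R3 R4 Q_def by (simp add: mat_dim_simps dW')
    moreover have "P = W * R * cadj W"
      by (simp add: R_def mat_dim_simps dW dP)
    ultimately have "P = (W * Q) * diag_fun_mat (Suc n) (\<lambda>i. if i < Suc r then 1 else 0) * cadj (W * Q)"
      by (simp add: mat_dim_simps dW unitary_matD[OF Q])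
    then show ?thesis
      using unitary_mult[OF W(1) Q] r by (intro exI[of _ "W * Q"] exI[of _ "Suc r"]) auto
  qed
qed

section \<open>Designs and their reduction\<close>

text \<open>Hiding the coefficients reduces the shape of an entry to closure properties, with no
  coefficient tables to carry through products and extensions.\<close>

definition conj_linear :: "nat \<Rightarrow> ((nat \<Rightarrow> complex) \<Rightarrow> complex) \<Rightarrow> bool" where
  "conj_linear k f \<longleftrightarrow> (\<exists>a b. \<forall>z. f z = (\<Sum>i<k. a i * z i + b i * cnj (z i)))"

lemma conj_linearI: "(\<And>z. f z = (\<Sum>i<k. a i * z i + b i * cnj (z i))) \<Longrightarrow> conj_linear k f"
  by (auto simp: conj_linear_def)

lemma conj_linearE:
  assumes "conj_linear k f"
  obtains a b where "\<And>z. f z = (\<Sum>i<k. a i * z i + b i * cnj (z i))"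
  using assms unfolding conj_linear_def by blast

lemma conj_linear_zero: "conj_linear k (\<lambda>z. 0)"
  by (rule conj_linearI[of _ "\<lambda>_. 0" "\<lambda>_. 0"]) simp

lemma conj_linear_var: "j < k \<Longrightarrow> conj_linear k (\<lambda>z. z j)"
  by (rule conj_linearI[of _ "\<lambda>i. if i = j then 1 else 0" "\<lambda>_. 0"])
     (simp add: if_distrib[of "\<lambda>x. x * _"] cong: if_cong)

lemma conj_linear_cnj:
  assumes "conj_linear k f"
  shows "conj_linear k (\<lambda>z. cnj (f z))"
proof -
  obtain a b where "\<And>z. f z = (\<Sum>i<k. a i * z i + b i * cnj (z i))"
    using conj_linearE[OF assms] by blast
  then show ?thesis
    by (intro conj_linearI[of _ "\<lambda>i. cnj (b i)" "\<lambda>i. cnj (a i)"]) (simp add: add.commute)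
qed

lemma conj_linear_add:
  assumes "conj_linear k f" "conj_linear k g"
  shows "conj_linear k (\<lambda>z. f z + g z)"
proof -
  obtain a b where f: "\<And>z. f z = (\<Sum>i<k. a i * z i + b i * cnj (z i))"
    using conj_linearE[OF assms(1)] by blast
  obtain a' b' where g: "\<And>z. g z = (\<Sum>i<k. a' i * z i + b' i * cnj (z i))"
    using conj_linearE[OF assms(2)] by blast
  show ?thesis
    by (rule conj_linearI[of _ "\<lambda>i. a i + a' i" "\<lambda>i. b i + b' i"])
       (simp add: f g algebra_simps sum.distrib)
qed

lemma conj_linear_cmult:
  assumes "conj_linear k f"
  shows "conj_linear k (\<lambda>z. c * f z)"
proof -
  obtain a b where f: "\<And>z. f z = (\<Sum>i<k. a i * z i + b i * cnj (z i))"
    using conj_linearE[OF assms] by blast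
  show ?thesis
    by (rule conj_linearI[of _ "\<lambda>i. c * a i" "\<lambda>i. c * b i"])
       (simp add: f algebra_simps sum_distrib_left)
qed

lemma conj_linear_sum:
  "(\<And>l. l \<in> L \<Longrightarrow> conj_linear k (f l)) \<Longrightarrow> conj_linear k (\<lambda>z. \<Sum>l\<in>L. f l z)"
  by (induction L rule: infinite_finite_induct) (simp_all add: conj_linear_zero conj_linear_add)

lemma conj_linear_Suc:
  assumes "conj_linear k f"
  shows "conj_linear (Suc k) f"
proof -
  obtain a b where f: "\<And>z. f z = (\<Sum>i<k. a i * z i + b i * cnj (z i))"
    using conj_linearE[OF assms] by blast
  show ?thesis
    by (rule conj_linearI[of _ "\<lambda>i. if i < k then a i else 0" "\<lambda>i. if i < k then b i else 0"])
       (simp add: f)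
qed

lemma conj_linear_split_last:
  assumes "conj_linear (Suc k) f"
  shows "conj_linear k (\<lambda>z. f (z(k := 0)))"
    and "\<exists>a b. \<forall>z. f z = f (z(k := 0)) + (z k * a + cnj (z k) * b)"
proof -
  obtain a b where f: "\<And>z. f z = (\<Sum>i<Suc k. a i * z i + b i * cnj (z i))"
    using conj_linearE[OF assms] by blast
  show "conj_linear k (\<lambda>z. f (z(k := 0)))"
    by (rule conj_linearI[of _ a b]) (simp add: f)
  show "\<exists>a b. \<forall>z. f z = f (z(k := 0)) + (z k * a + cnj (z k) * b)"
    by (intro exI[of _ "a k"] exI[of _ "b k"]) (simp add: f mult.commute)
qed

lemma conj_linear_at_zero: "conj_linear k f \<Longrightarrow> f (\<lambda>_. 0) = 0"
  by (auto simp: conj_linear_def)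

section \<open>Designs as matrix-valued functions, and the removal of the last variable\<close>

text \<open>The table-free counterpart of \<open>square_COD\<close>;
  \<open>is_cod_lin_mat_iff\<close> and \<open>is_cod_imp_lin_mat\<close> translate to and from
  coefficient tables.\<close>

definition is_cod :: "nat \<Rightarrow> nat \<Rightarrow> ((nat \<Rightarrow> complex) \<Rightarrow> complex mat) \<Rightarrow> bool" where
  "is_cod n k F \<longleftrightarrow> (\<forall>z. F z \<in> carrier_mat n n) \<and>
     (\<forall>i<n. \<forall>j<n. conj_linear k (\<lambda>z. F z $$ (i, j))) \<and>
     (\<forall>z. cadj (F z) * F z = complex_of_real (\<Sum>i<k. (cmod (z i))\<^sup>2) \<cdot>\<^sub>m 1\<^sub>m n)"

lemma is_codD:
  assumes "is_cod n k F"
  shows "F z \<in> carrier_mat n n" "dim_row (F z) = n" "dim_col (F z) = n"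
    "i < n \<Longrightarrow> j < n \<Longrightarrow> conj_linear k (\<lambda>z. F z $$ (i, j))"
    "cadj (F z) * F z = complex_of_real (\<Sum>i<k. (cmod (z i))\<^sup>2) \<cdot>\<^sub>m 1\<^sub>m n"
  using assms by (auto simp: is_cod_def simp del: of_real_sum)

lemma is_cod_lin_mat_iff: "is_cod n k (lin_mat n k \<alpha> \<beta>) \<longleftrightarrow> square_COD n k \<alpha> \<beta>"
  by (auto simp: is_cod_def square_COD_def lin_mat_def intro!: conj_linearI)

lemma is_cod_imp_lin_mat:
  assumes "is_cod n k F"
  obtains \<alpha> \<beta> where "F = lin_mat n k \<alpha> \<beta>"
proof -
  have "\<forall>i j. \<exists>a b. i < n \<longrightarrow> j < n \<longrightarrow> (\<forall>z. F z $$ (i, j) = (\<Sum>l<k. a l * z l + b l * cnj (z l)))"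
    using is_codD(4)[OF assms] unfolding conj_linear_def by blast
  then obtain \<alpha> \<beta> where F: "\<And>i j z. i < n \<Longrightarrow> j < n \<Longrightarrow>
      F z $$ (i, j) = (\<Sum>l<k. \<alpha> i j l * z l + \<beta> i j l * cnj (z l))"
    by metis
  have "F z = lin_mat n k \<alpha> \<beta> z" for z
    by (rule eq_matI) (simp_all add: F lin_mat_def is_codD(2,3)[OF assms])
  then show thesis
    using that by blast
qed

lemma is_cod_mult:
  assumes G: "is_cod n k G" and U: "unitary_mat n U" and V: "unitary_mat n V"
  shows "is_cod n k (\<lambda>z. U * G z * V)"
  unfolding is_cod_def
proof (intro conjI allI impI)
  note d = unitary_matD[OF U] unitary_matD[OF V] is_codD(2,3)[OF G]
  fix z
  show "U * G z * V \<in> carrier_mat n n"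
    using d by auto
  have "cadj (U * G z * V) * (U * G z * V) = cadj V * ((cadj (G z) * G z) * V)"
    by (simp add: mat_dim_simps d)
  then show "cadj (U * G z * V) * (U * G z * V) = complex_of_real (\<Sum>i<k. (cmod (z i))\<^sup>2) \<cdot>\<^sub>m 1\<^sub>m n"
    by (simp add: is_codD(5)[OF G] mat_dim_simps d del: of_real_sum)
next
  note d = unitary_matD(1,2)[OF U] unitary_matD(1,2)[OF V] is_codD(2,3)[OF G]
  fix i j assume ij: "i < n" "j < n"
  have eq: "(\<lambda>z. (U * G z * V) $$ (i, j)) =
      (\<lambda>z. \<Sum>l<n. V $$ (l, j) * (\<Sum>m<n. U $$ (i, m) * G z $$ (m, l)))"
    using ij by (simp add: scalar_prod_def d atLeast0LessThan mult.commute)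
  show "conj_linear k (\<lambda>z. (U * G z * V) $$ (i, j))"
    unfolding eq by (intro conj_linear_sum conj_linear_cmult is_codD(4)[OF G]) auto
qed

lemma is_cod_split_last:
  assumes "is_cod n (Suc k) F"
  shows "is_cod n k (\<lambda>z. F (z(k := 0)))"
    and "\<exists>A B. A \<in> carrier_mat n n \<and> B \<in> carrier_mat n n \<and>
      (\<forall>z. F z = F (z(k := 0)) + (z k \<cdot>\<^sub>m A + cnj (z k) \<cdot>\<^sub>m B))"
proof -
  note d = is_codD(1-3)[OF assms]
  show "is_cod n k (\<lambda>z. F (z(k := 0)))"
    unfolding is_cod_def
    by (auto simp: is_codD(5)[OF assms] d(1) simp del: of_real_sum
        intro!: conj_linear_split_last(1)[OF is_codD(4)[OF assms]])
  have "\<forall>i j. \<exists>a b. i < n \<longrightarrow> j < n \<longrightarrow>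
      (\<forall>z. F z $$ (i, j) = F (z(k := 0)) $$ (i, j) + (z k * a + cnj (z k) * b))"
    using conj_linear_split_last(2)[OF is_codD(4)[OF assms]] by blast
  then obtain a b where ab: "\<And>i j z. i < n \<Longrightarrow> j < n \<Longrightarrow>
      F z $$ (i, j) = F (z(k := 0)) $$ (i, j) + (z k * a i j + cnj (z k) * b i j)"
    by metis
  show "\<exists>A B. A \<in> carrier_mat n n \<and> B \<in> carrier_mat n n \<and>
      (\<forall>z. F z = F (z(k := 0)) + (z k \<cdot>\<^sub>m A + cnj (z k) \<cdot>\<^sub>m B))"
  proof (intro exI conjI allI)
    fix z
    show "F z = F (z(k := 0)) + (z k \<cdot>\<^sub>m mat n n (\<lambda>(i, j). a i j) + cnj (z k) \<cdot>\<^sub>m mat n n (\<lambda>(i, j). b i j))"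
    proof (rule eq_matI)
      fix i j
      assume "i < dim_row (F (z(k := 0)) + (z k \<cdot>\<^sub>m mat n n (\<lambda>(i, j). a i j) + cnj (z k) \<cdot>\<^sub>m mat n n (\<lambda>(i, j). b i j)))"
        and "j < dim_col (F (z(k := 0)) + (z k \<cdot>\<^sub>m mat n n (\<lambda>(i, j). a i j) + cnj (z k) \<cdot>\<^sub>m mat n n (\<lambda>(i, j). b i j)))"
      then show "F z $$ (i, j) = (F (z(k := 0)) + (z k \<cdot>\<^sub>m mat n n (\<lambda>(i, j). a i j) + cnj (z k) \<cdot>\<^sub>m mat n n (\<lambda>(i, j). b i j))) $$ (i, j)"
        using ab[of i j z] by (simp add: d)
    qed (simp_all add: d)
  qed simp_all
qed

lemma is_cod_at_zero:
  assumes "is_cod n k F"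
  shows "F (\<lambda>_. 0) = 0\<^sub>m n n"
  by (rule eq_matI) (simp_all add: is_codD(2,3)[OF assms] conj_linear_at_zero[OF is_codD(4)[OF assms]])

text \<open>The value w = \<i> makes K = \<i> (A - B) unitary, and w = 1 + \<i> forces K + K^H = 0.
  Hence K K = -1, and A = (1 - \<i> K) / 2 is a Hermitian projection.\<close>

lemma projection_of_skew_unitary:
  assumes A: "A \<in> carrier_mat n n" and B: "B \<in> carrier_mat n n" and sum: "A + B = 1\<^sub>m n"
    and iso: "\<And>w. cadj (w \<cdot>\<^sub>m A + cnj w \<cdot>\<^sub>m B) * (w \<cdot>\<^sub>m A + cnj w \<cdot>\<^sub>m B) = complex_of_real ((cmod w)\<^sup>2) \<cdot>\<^sub>m 1\<^sub>m n"
  shows "cadj A = A" "A * A = A"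
proof -
  define K where "K = \<i> \<cdot>\<^sub>m A + (- \<i>) \<cdot>\<^sub>m B"
  have d: "dim_row A = n" "dim_col A = n" "dim_row B = n" "dim_col B = n" "dim_row K = n" "dim_col K = n"
    using A B by (auto simp: K_def)
  have sum_ij: "A $$ (i, j) + B $$ (i, j) = 1\<^sub>m n $$ (i, j)" if "i < n" "j < n" for i j
    using arg_cong[OF sum, of "\<lambda>M. M $$ (i, j)"] that by (simp add: d)
  have KK: "cadj K * K = 1\<^sub>m n"
    using iso[of \<i>] by (simp add: K_def mat_dim_simps)
  \<comment> \<open>Polarisation: both 1 and K are isometries and the squared norm at 1 + \<i> is 2,
    so exactly the cross terms K and K^H must cancel.\<close>
  have "1\<^sub>m n + K = (1 + \<i>) \<cdot>\<^sub>m A + cnj (1 + \<i>) \<cdot>\<^sub>m B"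
    by (rule eq_matI) (simp_all add: K_def d sum_ij[symmetric] algebra_simps del: index_one_mat(1))
  then have "cadj (1\<^sub>m n + K) * (1\<^sub>m n + K) = complex_of_real ((cmod (1 + \<i>))\<^sup>2) \<cdot>\<^sub>m 1\<^sub>m n"
    by (simp only: iso)
  also have "(cmod (1 + \<i>))\<^sup>2 = 2"
    by (simp add: cmod_power2)
  finally have "1\<^sub>m n + cadj K + (K + 1\<^sub>m n) = 2 \<cdot>\<^sub>m 1\<^sub>m n"
    by (simp add: mat_dim_simps d KK)
  then have skew_ij: "(1\<^sub>m n + cadj K + (K + 1\<^sub>m n)) $$ (i, j) = (2 \<cdot>\<^sub>m 1\<^sub>m n) $$ (i, j)" for i j
    by simp
  have skew: "cadj K = (-1) \<cdot>\<^sub>m K"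
  proof (rule eq_matI)
    fix i j assume "i < dim_row ((-1) \<cdot>\<^sub>m K)" "j < dim_col ((-1) \<cdot>\<^sub>m K)"
    then show "cadj K $$ (i, j) = ((-1) \<cdot>\<^sub>m K) $$ (i, j)"
      using skew_ij[of i j] by (simp add: d eq_neg_iff_add_eq_0 split: if_splits)
  qed (simp_all add: d)
  have A_eq: "A = (1 / 2) \<cdot>\<^sub>m (1\<^sub>m n + (- \<i>) \<cdot>\<^sub>m K)"
    by (rule eq_matI) (simp_all add: K_def d sum_ij[symmetric] algebra_simps del: index_one_mat(1))
  have "(-1) \<cdot>\<^sub>m (K * K) = 1\<^sub>m n"
    using KK by (simp add: skew mat_dim_simps d)
  then have "(-1) \<cdot>\<^sub>m ((-1) \<cdot>\<^sub>m (K * K)) = (-1) \<cdot>\<^sub>m 1\<^sub>m n"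
    by (rule arg_cong)
  then have K2: "K * K = (-1) \<cdot>\<^sub>m 1\<^sub>m n"
    by (simp add: mat_dim_simps)
  show "cadj A = A"
    unfolding A_eq by (simp add: mat_dim_simps d skew)
  show "A * A = A"
    unfolding A_eq
    by (simp add: mat_dim_simps d K2, rule eq_matI) (simp_all add: d field_simps)
qed

lemma cod_normal_form_last:
  assumes F: "is_cod n (Suc k) F"
  obtains r G where "r \<le> n" "is_cod n (Suc k) G" "unitarily_equiv n F G"
    "\<And>z. G z = G (z(k := 0)) + diag_fun_mat n (\<lambda>i. if i < r then z k else cnj (z k))"
proof -
  obtain A B where A: "A \<in> carrier_mat n n" and B: "B \<in> carrier_mat n n"
    and AB: "\<And>z. F z = F (z(k := 0)) + (z k \<cdot>\<^sub>m A + cnj (z k) \<cdot>\<^sub>m B)"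
    using is_cod_split_last(2)[OF F] by blast
  note d = is_codD(2,3)[OF F] carrier_matD[OF A] carrier_matD[OF B]
  have axis: "F ((\<lambda>_. 0)(k := w)) = w \<cdot>\<^sub>m A + cnj w \<cdot>\<^sub>m B" for w
  proof -
    have "((\<lambda>_. 0)(k := w))(k := 0) = (\<lambda>_. 0)"
      by auto
    then show ?thesis
      using AB[of "(\<lambda>_. 0)(k := w)"] by (simp add: is_cod_at_zero[OF F] d mat_dim_simps)
  qed
  have iso: "cadj (w \<cdot>\<^sub>m A + cnj w \<cdot>\<^sub>m B) * (w \<cdot>\<^sub>m A + cnj w \<cdot>\<^sub>m B) = complex_of_real ((cmod w)\<^sup>2) \<cdot>\<^sub>m 1\<^sub>m n" for w
    using is_codD(5)[OF F, of "(\<lambda>_. 0)(k := w)"] unfolding axis by simp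
  \<comment> \<open>E is the value of F at the unit vector of the last variable, hence unitary;
    multiplying by E^H makes the two coefficients sum to the identity.\<close>
  define E where "E = A + B"
  have dE: "dim_row E = n" "dim_col E = n"
    by (simp_all add: E_def d)
  have E: "unitary_mat n E"
    using iso[of 1] by (intro unitary_matI) (simp_all add: dE, simp add: E_def one_smult_mat)
  note dE = unitary_matD[OF E]
  have "cadj (cadj E * A) = cadj E * A" and "cadj E * A * (cadj E * A) = cadj E * A"
  proof -
    have "cadj E * A + cadj E * B = cadj E * E"
      by (simp add: E_def mult_add_dim d)
    then have sum: "cadj E * A + cadj E * B = 1\<^sub>m n"
      by (simp add: dE)
    have "cadj (w \<cdot>\<^sub>m (cadj E * A) + cnj w \<cdot>\<^sub>m (cadj E * B)) * (w \<cdot>\<^sub>m (cadj E * A) + cnj w \<cdot>\<^sub>m (cadj E * B)) =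
        complex_of_real ((cmod w)\<^sup>2) \<cdot>\<^sub>m 1\<^sub>m n" for w
    proof -
      have "w \<cdot>\<^sub>m (cadj E * A) + cnj w \<cdot>\<^sub>m (cadj E * B) = cadj E * (w \<cdot>\<^sub>m A + cnj w \<cdot>\<^sub>m B)"
        by (simp add: mat_dim_simps d dE)
      moreover have "cadj (cadj E * X) * (cadj E * X) = cadj X * X" if "dim_row X = n" for X
        using that by (simp add: mat_dim_simps dE)
      ultimately show ?thesis
        using iso[of w] by (simp add: d)
    qed
    from projection_of_skew_unitary[OF _ _ sum this]
    show "cadj (cadj E * A) = cadj E * A" "cadj E * A * (cadj E * A) = cadj E * A"
      using A B cadj_carrier[OF unitary_mat_carrier[OF E]] by auto
  qed
  then obtain W r where W: "unitary_mat n W" and r: "r \<le> n"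
    and EA: "cadj E * A = W * diag_fun_mat n (\<lambda>i. if i < r then 1 else 0) * cadj W"
    using hermitian_projection_diagonal[of "cadj E * A" n] A cadj_carrier[OF unitary_mat_carrier[OF E]]
    by auto
  note dW = unitary_matD[OF W]
  define G where "G z = (cadj W * cadj E) * F z * W" for z
  have WE: "unitary_mat n (cadj W * cadj E)"
    by (intro unitary_mult unitary_cadj W E)
  have G: "is_cod n (Suc k) G"
    unfolding G_def using F WE W by (rule is_cod_mult)
  have FG: "unitarily_equiv n F G"
    by (rule unitarily_equivI[OF unitary_mult[OF E W] unitary_cadj[OF W]])
       (simp add: G_def mat_dim_simps d dE dW)
  have A': "cadj W * (cadj E * (A * W)) = diag_fun_mat n (\<lambda>i. if i < r then 1 else 0)"
  proof -
    have "cadj W * (cadj E * (A * W)) = cadj W * (cadj E * A) * W"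
      by (simp add: mat_dim_simps d dE dW)
    then show ?thesis
      by (simp add: EA mat_dim_simps dW)
  qed
  have "cadj W * (cadj E * (A * W)) + cadj W * (cadj E * (B * W)) = cadj W * (cadj E * ((A + B) * W))"
    by (simp add: mat_dim_simps d dE(1,2) dW(1,2))
  then have AB1: "cadj W * (cadj E * (A * W)) + cadj W * (cadj E * (B * W)) = 1\<^sub>m n"
    by (simp add: dE dW flip: E_def)
  \<comment> \<open>After the normalisation the coefficient of the conjugate is the complementary
    projection, so the same W diagonalises it.\<close>
  have B': "cadj W * (cadj E * (B * W)) = diag_fun_mat n (\<lambda>i. if i < r then 0 else 1)"
  proof (rule eq_matI)
    fix i j assume "i < dim_row (diag_fun_mat n (\<lambda>i. if i < r then 0 else 1))"
      "j < dim_col (diag_fun_mat n (\<lambda>i. if i < r then 0 else 1))"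
    then show "(cadj W * (cadj E * (B * W))) $$ (i, j) = diag_fun_mat n (\<lambda>i. if i < r then 0 else 1) $$ (i, j)"
      using arg_cong[OF AB1, of "\<lambda>M. M $$ (i, j)"] unfolding A'
      by (simp add: d dE dW del: index_mult_mat(1) split: if_splits)
  qed (simp_all add: d dE dW)
  have "G z = G (z(k := 0)) + diag_fun_mat n (\<lambda>i. if i < r then z k else cnj (z k))" for z
  proof -
    have "G z = G (z(k := 0)) + (z k \<cdot>\<^sub>m (cadj W * (cadj E * (A * W))) + cnj (z k) \<cdot>\<^sub>m (cadj W * (cadj E * (B * W))))"
      unfolding G_def by (subst AB) (simp add: mat_dim_simps d dE dW)
    also have "z k \<cdot>\<^sub>m (cadj W * (cadj E * (A * W))) + cnj (z k) \<cdot>\<^sub>m (cadj W * (cadj E * (B * W))) =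
        diag_fun_mat n (\<lambda>i. if i < r then z k else cnj (z k))"
      unfolding A' B' by (rule eq_matI) auto
    finally show ?thesis .
  qed
  with r G FG show thesis
    by (rule that)
qed

text \<open>Subtracting the identities for g (last variable 0) and for the diagonal part D from the
  one for g + D leaves g^H D + D^H g = 0. At w = 1 this says that g is skew-Hermitian; at w = \<i>,
  where D is \<i> times a diagonal of signs, it then kills the entries that join two indices of
  equal sign.\<close>

lemma cod_last_anticommutes:
  assumes G: "is_cod n (Suc k) G"
    and split: "\<And>z. G z = G (z(k := 0)) + diag_fun_mat n (\<lambda>i. if i < r then z k else cnj (z k))"
    and ij: "i < n" "j < n"
  shows "G (z(k := 0)) $$ (i, j) = - cnj (G (z(k := 0)) $$ (j, i))"
    and "i < r \<longleftrightarrow> j < r \<Longrightarrow> G (z(k := 0)) $$ (i, j) = 0"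
proof -
  define g where "g = G (z(k := 0))"
  note d = is_codD(2,3)[OF G]
  have dg: "dim_row g = n" "dim_col g = n"
    by (simp_all add: g_def d)
  have cross: "cnj (g $$ (j, i)) * \<delta> j + cnj (\<delta> i) * g $$ (i, j) = 0"
    if \<delta>: "\<delta> = (\<lambda>i. if i < r then w else cnj w)" for w \<delta>
  proof -
    let ?D = "diag_fun_mat n \<delta>"
    let ?s = "complex_of_real (\<Sum>i<k. (cmod (z i))\<^sup>2)" and ?t = "complex_of_real ((cmod w)\<^sup>2)"
    have "G (z(k := w)) = g + ?D"
      using split[of "z(k := w)"] unfolding fun_upd_same fun_upd_upd g_def \<delta> .
    then have "cadj (g + ?D) * (g + ?D) = (?s + ?t) \<cdot>\<^sub>m 1\<^sub>m n"
      using is_codD(5)[OF G, of "z(k := w)"] by simp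
    moreover have "cadj g * g = ?s \<cdot>\<^sub>m 1\<^sub>m n"
      using is_codD(5)[OF G, of "z(k := 0)"] by (simp add: g_def)
    moreover have "cadj ?D * ?D = ?t \<cdot>\<^sub>m 1\<^sub>m n"
      unfolding cadj_diag_fun_mat
      by (rule eq_matI) (auto simp: \<delta> diag_fun_mat_mult complex_norm_square mult.commute
          simp del: index_mult_mat(1) of_real_power)
    ultimately have "?s \<cdot>\<^sub>m 1\<^sub>m n + cadj ?D * g + (cadj g * ?D + ?t \<cdot>\<^sub>m 1\<^sub>m n) = (?s + ?t) \<cdot>\<^sub>m 1\<^sub>m n"
      by (simp add: mat_dim_simps dg)
    then have "(?s \<cdot>\<^sub>m 1\<^sub>m n + cadj ?D * g + (cadj g * ?D + ?t \<cdot>\<^sub>m 1\<^sub>m n)) $$ (i, j) = ((?s + ?t) \<cdot>\<^sub>m 1\<^sub>m n) $$ (i, j)"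
      by simp
    then have "(cadj ?D * g) $$ (i, j) + (cadj g * ?D) $$ (i, j) = 0"
      using ij by (simp add: dg algebra_simps del: index_mult_mat(1) split: if_splits)
    then show ?thesis
      unfolding cadj_diag_fun_mat using ij
      by (simp add: dg mult_diag_fun_mat diag_fun_mat_mult add.commute del: index_mult_mat(1))
  qed
  have skew: "g $$ (i, j) = - cnj (g $$ (j, i))"
    using cross[OF refl, of 1] by (simp add: eq_neg_iff_add_eq_0 add.commute split: if_splits)
  then show "G (z(k := 0)) $$ (i, j) = - cnj (G (z(k := 0)) $$ (j, i))"
    by (simp add: g_def)
  have "g $$ (i, j) = 0" if "i < r \<longleftrightarrow> j < r"
    using cross[OF refl, of \<i>] skew that by (auto simp: complex_eq_iff split: if_splits)
  then show "i < r \<longleftrightarrow> j < r \<Longrightarrow> G (z(k := 0)) $$ (i, j) = 0"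
    by (simp add: g_def)
qed

text \<open>By \<open>cod_last_anticommutes\<close> the design has zero diagonal blocks when the
  last variable is 0. The hypothesis on k supplies another variable, without which the two blocks
  may differ in size.\<close>

lemma cod_reduction:
  assumes F: "is_cod n (Suc k) F" and k: "1 \<le> k"
  obtains r Y where "n = r + r" "is_cod r k Y" "unitarily_equiv n F (\<lambda>z. design_ext (z k) (Y z))"
proof -
  obtain r G where r: "r \<le> n" and G: "is_cod n (Suc k) G" and FG: "unitarily_equiv n F G"
    and split: "\<And>z. G z = G (z(k := 0)) + diag_fun_mat n (\<lambda>i. if i < r then z k else cnj (z k))"
    using cod_normal_form_last[OF F] by blast
  note G0 = is_cod_split_last(1)[OF G]
  have skew: "G (z(k := 0)) $$ (i, j) = - cnj (G (z(k := 0)) $$ (j, i))" if "i < n" "j < n" for i j z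
    by (rule cod_last_anticommutes(1)[OF G split that])
  have vanish: "G (z(k := 0)) $$ (i, j) = 0" if "i < n" "j < n" "i < r \<longleftrightarrow> j < r" for i j z
    by (rule cod_last_anticommutes(2)[OF G split that])
  note d = is_codD(2,3)[OF G]
  have n: "n = r + r"
  proof -
    \<comment> \<open>A point of norm 1 in the remaining variables, where G with last variable 0 is
      unitary. Its nonzero entries join {..<r} and {r..<n} only, so these sets have equally many
      elements.\<close>
    let ?e = "(\<lambda>_. 0)(0 := 1 :: complex)"
    have "(\<Sum>i<k. (cmod (?e i))\<^sup>2) = (\<Sum>i<k. if i = 0 then 1 else 0)"
      by (rule sum.cong) auto
    also have "\<dots> = 1"
      using k by simp
    finally have "unitary_mat n (G (?e(k := 0)))"
      using is_codD(5)[OF G0, of ?e] by (intro unitary_matI) (simp_all add: d one_smult_mat del: of_real_sum)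
    then have "card {..<r} = card {r..<n}"
      by (rule unitary_support_card) (use r vanish in \<open>fastforce simp: not_less\<close>)+
    then show ?thesis
      using r by simp
  qed
  define Y where "Y z = mat r r (\<lambda>(i, j). G (z(k := 0)) $$ (i, j + r))" for z
  have dY: "dim_row (Y z) = r" "dim_col (Y z) = r" for z
    by (simp_all add: Y_def)
  have G0_eq: "G (z(k := 0)) = four_block_mat (0\<^sub>m r r) (Y z) ((-1) \<cdot>\<^sub>m cadj (Y z)) (0\<^sub>m r r)" for z
  proof (rule eq_matI)
    fix i j
    assume "i < dim_row (four_block_mat (0\<^sub>m r r) (Y z) ((-1) \<cdot>\<^sub>m cadj (Y z)) (0\<^sub>m r r))"
      "j < dim_col (four_block_mat (0\<^sub>m r r) (Y z) ((-1) \<cdot>\<^sub>m cadj (Y z)) (0\<^sub>m r r))"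
    then have "i < r + r" "j < r + r"
      by simp_all
    then show "G (z(k := 0)) $$ (i, j) = four_block_mat (0\<^sub>m r r) (Y z) ((-1) \<cdot>\<^sub>m cadj (Y z)) (0\<^sub>m r r) $$ (i, j)"
      using vanish[of i j z] skew[of i j z] n by (auto simp: Y_def)
  qed (simp_all add: d n)
  have diag: "diag_fun_mat n (\<lambda>i. if i < r then w else cnj w) =
      four_block_mat (w \<cdot>\<^sub>m 1\<^sub>m r) (0\<^sub>m r r) (0\<^sub>m r r) (cnj w \<cdot>\<^sub>m 1\<^sub>m r)" for w
    by (rule eq_matI) (auto simp: n)
  \<comment> \<open>A sign change of the lower rows and an exchange of the column halves move the
    last variable from the diagonal to the off-diagonal blocks.\<close>
  have "G z = four_block_mat (1\<^sub>m r) (0\<^sub>m r r) (0\<^sub>m r r) ((-1) \<cdot>\<^sub>m 1\<^sub>m r) * design_ext (z k) (Y z) *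
      four_block_mat (0\<^sub>m r r) (1 \<cdot>\<^sub>m 1\<^sub>m r) (1 \<cdot>\<^sub>m 1\<^sub>m r) (0\<^sub>m r r)" for z
  proof -
    have "G z = four_block_mat (z k \<cdot>\<^sub>m 1\<^sub>m r) (Y z) ((-1) \<cdot>\<^sub>m cadj (Y z)) (cnj (z k) \<cdot>\<^sub>m 1\<^sub>m r)"
      by (subst split, subst diag, subst G0_eq, rule eq_matI) (auto simp: dY)
    then show ?thesis
      by (simp add: design_ext_def mat_dim_simps dY)
  qed
  moreover have "unitary_mat n (four_block_mat (1\<^sub>m r) (0\<^sub>m r r) (0\<^sub>m r r) ((-1) \<cdot>\<^sub>m 1\<^sub>m r))"
    unfolding n by (intro unitary_four_block_diag unitary_smult) simp_all
  moreover have "unitary_mat n (four_block_mat (0\<^sub>m r r) (1 \<cdot>\<^sub>m 1\<^sub>m r) (1 \<cdot>\<^sub>m 1\<^sub>m r) (0\<^sub>m r r))"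
    unfolding n by (intro unitary_four_block_antidiag) simp_all
  ultimately have "unitarily_equiv n G (\<lambda>z. design_ext (z k) (Y z))"
    by (intro unitarily_equivI)
  then have "unitarily_equiv n F (\<lambda>z. design_ext (z k) (Y z))"
    by (rule unitarily_equiv_trans[OF FG]) (auto simp: n dY)
  moreover have "is_cod r k Y"
    unfolding is_cod_def
  proof (intro conjI allI impI)
    fix z
    show "Y z \<in> carrier_mat r r"
      by (simp add: Y_def)
    let ?s = "complex_of_real (\<Sum>i<k. (cmod (z i))\<^sup>2)"
    have "four_block_mat (Y z * cadj (Y z)) (0\<^sub>m r r) (0\<^sub>m r r) (cadj (Y z) * Y z) =
        four_block_mat (?s \<cdot>\<^sub>m 1\<^sub>m r) (0\<^sub>m r r) (0\<^sub>m r r) (?s \<cdot>\<^sub>m 1\<^sub>m r)"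
    proof -
      have "?s \<cdot>\<^sub>m 1\<^sub>m n = four_block_mat (?s \<cdot>\<^sub>m 1\<^sub>m r) (0\<^sub>m r r) (0\<^sub>m r r) (?s \<cdot>\<^sub>m 1\<^sub>m r)"
        by (rule eq_matI) (auto simp: n)
      then show ?thesis
        using is_codD(5)[OF G0, of z] unfolding G0_eq by (simp add: mat_dim_simps dY del: of_real_sum)
    qed
    from four_block_inject(4)[OF this, of r r r r] show "cadj (Y z) * Y z = ?s \<cdot>\<^sub>m 1\<^sub>m r"
      by (simp add: dY)
  next
    fix i j assume "i < r" "j < r"
    then show "conj_linear k (\<lambda>z. Y z $$ (i, j))"
      using is_codD(4)[OF G0, of i "j + r"] by (simp add: Y_def n)
  qed
  ultimately show thesis
    using that n by blast
qed

section \<open>The canonical designs\<close>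

text \<open>The lower right block of the product involves F F^H, while \<open>is_cod\<close> only
  speaks of F^H F.\<close>

lemma is_cod_design_ext:
  assumes F: "is_cod n k F"
  shows "is_cod (n + n) (Suc k) (\<lambda>z. design_ext (z k) (F z))"
  unfolding is_cod_def
proof (intro conjI allI impI)
  note d = is_codD(2,3)[OF F]
  fix z
  show "design_ext (z k) (F z) \<in> carrier_mat (n + n) (n + n)"
    using d by auto
  let ?s = "complex_of_real (\<Sum>i<k. (cmod (z i))\<^sup>2)"
  let ?t = "complex_of_real (\<Sum>i<Suc k. (cmod (z i))\<^sup>2)"
  have FF: "cadj (F z) * F z = ?s \<cdot>\<^sub>m 1\<^sub>m n"
    by (rule is_codD(5)[OF F])
  \<comment> \<open>If \<open>?s\<close> is nonzero, F^H / \<open>?s\<close> is a left inverse of a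
    square matrix and thus a right inverse. If \<open>?s\<close> is 0, all k variables vanish and
    with them the entries of F.\<close>
  have FF': "F z * cadj (F z) = ?s \<cdot>\<^sub>m 1\<^sub>m n"
  proof (cases "?s = 0")
    case True
    have "F z = 0\<^sub>m n n"
    proof (rule eq_matI)
      fix i j assume "i < dim_row (0\<^sub>m n n)" "j < dim_col (0\<^sub>m n n)"
      then have ij: "i < n" "j < n"
        by auto
      have "z l = 0" if "l < k" for l
      proof -
        have "(\<Sum>i<k. (cmod (z i))\<^sup>2) = 0"
          using True by (simp only: of_real_eq_0_iff)
        then show ?thesis
          using that by (simp add: sum_nonneg_eq_0_iff)
      qed
      then show "F z $$ (i, j) = 0\<^sub>m n n $$ (i, j)"
        using is_codD(4)[OF F ij] ij by (auto simp: conj_linear_def)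
    qed (simp_all add: d)
    then show ?thesis
      by (subst True) (auto intro!: eq_matI)
  next
    case False
    have "((1 / ?s) \<cdot>\<^sub>m cadj (F z)) * F z = 1\<^sub>m n"
      using False by (simp add: mat_dim_simps d FF del: of_real_sum)
    then have "F z * ((1 / ?s) \<cdot>\<^sub>m cadj (F z)) = 1\<^sub>m n"
      by (rule mat_mult_left_right_inverse[rotated 2]) (use d in auto)
    then have "?s \<cdot>\<^sub>m (F z * ((1 / ?s) \<cdot>\<^sub>m cadj (F z))) = ?s \<cdot>\<^sub>m 1\<^sub>m n"
      by (rule arg_cong)
    then show ?thesis
      using False by (simp add: mat_dim_simps d del: of_real_sum)
  qed
  have t: "?t = ?s + z k * cnj (z k)"
    by (simp add: complex_norm_square del: of_real_power)
  have "cadj (design_ext (z k) (F z)) * design_ext (z k) (F z) =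
      four_block_mat (?s \<cdot>\<^sub>m 1\<^sub>m n + (z k * cnj (z k)) \<cdot>\<^sub>m 1\<^sub>m n) (z k \<cdot>\<^sub>m cadj (F z) + (- z k) \<cdot>\<^sub>m cadj (F z))
        (cnj (z k) \<cdot>\<^sub>m F z + (- cnj (z k)) \<cdot>\<^sub>m F z) ((z k * cnj (z k)) \<cdot>\<^sub>m 1\<^sub>m n + ?s \<cdot>\<^sub>m 1\<^sub>m n)"
    by (simp add: design_ext_def mat_dim_simps d FF FF' mult.commute del: of_real_sum)
  also have "\<dots> = ?t \<cdot>\<^sub>m 1\<^sub>m (n + n)"
    unfolding t by (rule eq_matI) (auto simp: d)
  finally show "cadj (design_ext (z k) (F z)) * design_ext (z k) (F z) = ?t \<cdot>\<^sub>m 1\<^sub>m (n + n)" .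
next
  note d = is_codD(2,3)[OF F]
  fix i j assume ij: "i < n + n" "j < n + n"
  have lin: "conj_linear (Suc k) (\<lambda>z. F z $$ (i, j))" if "i < n" "j < n" for i j
    by (rule conj_linear_Suc[OF is_codD(4)[OF F that]])
  have var: "conj_linear (Suc k) (\<lambda>z. z k)"
    by (rule conj_linear_var) simp
  have "conj_linear (Suc k) (\<lambda>z. - cnj (z k))"
    using conj_linear_cmult[OF conj_linear_cnj[OF var], of "-1"] by simp
  then show "conj_linear (Suc k) (\<lambda>z. design_ext (z k) (F z) $$ (i, j))"
    using ij by (cases "i < n"; cases "j < n")
      (auto simp: design_ext_def d lin var conj_linear_zero intro!: conj_linear_cnj)
qed

lemma is_cod_dsum:
  assumes F: "is_cod m k F" and G: "is_cod n k G"
  shows "is_cod (m + n) k (\<lambda>z. dsum_mat (F z) (G z))"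
  unfolding is_cod_def
proof (intro conjI allI impI)
  note d = is_codD(2,3)[OF F] is_codD(2,3)[OF G]
  fix z
  show "dsum_mat (F z) (G z) \<in> carrier_mat (m + n) (m + n)"
    using d by auto
  let ?s = "complex_of_real (\<Sum>i<k. (cmod (z i))\<^sup>2)"
  have "cadj (dsum_mat (F z) (G z)) * dsum_mat (F z) (G z) =
      four_block_mat (?s \<cdot>\<^sub>m 1\<^sub>m m) (0\<^sub>m m n) (0\<^sub>m n m) (?s \<cdot>\<^sub>m 1\<^sub>m n)"
    by (simp add: dsum_mat_def mat_dim_simps d is_codD(5)[OF F] is_codD(5)[OF G] del: of_real_sum)
  also have "\<dots> = ?s \<cdot>\<^sub>m 1\<^sub>m (m + n)"
    by (rule eq_matI) auto
  finally show "cadj (dsum_mat (F z) (G z)) * dsum_mat (F z) (G z) = ?s \<cdot>\<^sub>m 1\<^sub>m (m + n)" .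
next
  note d = is_codD(2,3)[OF F] is_codD(2,3)[OF G]
  fix i j assume "i < m + n" "j < m + n"
  then show "conj_linear k (\<lambda>z. dsum_mat (F z) (G z) $$ (i, j))"
    by (cases "i < m"; cases "j < m")
       (simp_all add: dsum_mat_def d is_codD(4)[OF F] is_codD(4)[OF G] conj_linear_zero)
qed

lemma Cdes_carrier: "1 \<le> k \<Longrightarrow> Cdes k z \<in> carrier_mat (2 ^ (k - 1)) (2 ^ (k - 1))"
proof (induction k z rule: Cdes.induct)
  case (3 m z)
  then show ?case
    using four_block_carrier_mat[of "Cdes (Suc m) z" "2 ^ m" "2 ^ m" "cadj (Cdes (Suc m) z)" "2 ^ m" "2 ^ m"]
    by (simp add: mult_2)
qed simp_all

lemma Cdes_Suc: "1 \<le> k \<Longrightarrow> Cdes (Suc k) z = design_ext (z k) (Cdes k z)"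
proof (cases k)
  case (Suc m)
  then have "dim_row (Cdes (Suc m) z) = 2 ^ m"
    using Cdes_carrier[of "Suc m" z] by simp
  then show ?thesis
    by (simp add: Suc design_ext_def)
qed simp

text \<open>Its use is that the variable with index k, the one added by the next extension, can be
  overwritten freely.\<close>

lemma Cdes_cong: "(\<And>i. i < k \<Longrightarrow> z i = z' i) \<Longrightarrow> Cdes k z = Cdes k z'"
proof (induction k z rule: Cdes.induct)
  case (3 m z)
  then have "Cdes (Suc m) z = Cdes (Suc m) z'" "z (Suc m) = z' (Suc m)"
    by auto
  then show ?case
    by simp
qed simp_all

lemma Cdes_minus_cong: "(\<And>i. i < k \<Longrightarrow> z i = z' i) \<Longrightarrow> Cdes_minus k z = Cdes_minus k z'"
  unfolding Cdes_minus_def by (cases k) (auto intro!: Cdes_cong)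

lemma Cdes_minus_carrier: "1 \<le> k \<Longrightarrow> Cdes_minus k z \<in> carrier_mat (2 ^ (k - 1)) (2 ^ (k - 1))"
  unfolding Cdes_minus_def by (rule Cdes_carrier)

text \<open>Only the top variable is conjugated, so the inner design is \<open>Cdes k\<close>, not
  \<open>Cdes_minus k\<close>. Hence the extension of \<open>Cdes_minus k\<close> by z is merely
  equivalent to the next \<open>Cdes_minus\<close>.\<close>

lemma Cdes_minus_Suc:
  assumes "1 \<le> k"
  shows "Cdes_minus (Suc k) z = design_ext (cnj (z k)) (Cdes k z)"
proof -
  have "Cdes k (z(k := cnj (z k))) = Cdes k z"
    by (rule Cdes_cong) simp
  then show ?thesis
    using assms by (simp add: Cdes_minus_def Cdes_Suc)
qed

lemma design_ext_zero: "design_ext 0 (0\<^sub>m n n) = 0\<^sub>m (n + n) (n + n)"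
  by (rule eq_matI) (auto simp: design_ext_def)

lemma Cdes_zero: "1 \<le> k \<Longrightarrow> Cdes k (\<lambda>_. 0) = 0\<^sub>m (2 ^ (k - 1)) (2 ^ (k - 1))"
proof (induction k rule: dec_induct)
  case base
  show ?case
    by (rule eq_matI) auto
next
  case (step k)
  have "(2::nat) ^ k = 2 ^ (k - 1) + 2 ^ (k - 1)"
    using step.hyps by (simp flip: mult_2 power_Suc)
  then show ?case
    using step by (simp add: Cdes_Suc design_ext_zero)
qed

lemma Cdes_minus_zero: "1 \<le> k \<Longrightarrow> Cdes_minus k (\<lambda>_. 0) = 0\<^sub>m (2 ^ (k - 1)) (2 ^ (k - 1))"
  using Cdes_zero[of k] by (simp add: Cdes_minus_def fun_upd_idem)

lemma is_cod_Cdes: "1 \<le> k \<Longrightarrow> is_cod (2 ^ (k - 1)) k (Cdes k)"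
proof (induction k rule: dec_induct)
  case base
  have "conj_linear 1 (\<lambda>z. z 0)"
    by (rule conj_linear_var) simp
  then show ?case
    by (auto simp: is_cod_def scalar_prod_def complex_norm_square mult.commute
        simp del: of_real_power intro!: eq_matI)
next
  case (step k)
  have "(2::nat) ^ k = 2 ^ (k - 1) + 2 ^ (k - 1)"
    using step.hyps by (simp flip: mult_2 power_Suc)
  moreover have "Cdes (Suc k) = (\<lambda>z. design_ext (z k) (Cdes k z))"
    using step.hyps by (simp add: Cdes_Suc fun_eq_iff)
  ultimately show ?case
    using is_cod_design_ext[OF step.IH] by simp
qed

text \<open>For k = 1 the adjoint undoes the conjugation of the single entry. For larger k,
  \<open>cadj_design_ext\<close> swaps the halves and conjugates the top variable once more.\<close>

lemma cadj_Cdes_minus_equiv: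
  assumes "1 \<le> k"
  shows "unitarily_equiv (2 ^ (k - 1)) (\<lambda>z. cadj (Cdes_minus k z)) (Cdes k)"
proof (cases "k = 1")
  case True
  have "(\<lambda>z. cadj (Cdes_minus 1 z)) = Cdes 1"
    by (intro ext eq_matI) (simp_all add: Cdes_minus_def)
  moreover have "unitarily_equiv (2 ^ (1 - 1)) (Cdes 1) (Cdes 1)"
    by (intro unitarily_equiv_refl Cdes_carrier) simp
  ultimately show ?thesis
    by (simp only: True)
next
  case False
  then obtain m where k: "k = Suc m" "1 \<le> m"
    using assms by (cases k) auto
  then have pow: "(2::nat) ^ (k - 1) = 2 ^ (m - 1) + 2 ^ (m - 1)"
    by (simp flip: mult_2 power_Suc)
  have "Cdes k = (\<lambda>z. design_ext (cnj (cnj (z m))) (Cdes m z))"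
    "(\<lambda>z. cadj (Cdes_minus k z)) = (\<lambda>z. cadj (design_ext (cnj (z m)) (Cdes m z)))"
    using k by (simp_all add: fun_eq_iff Cdes_Suc Cdes_minus_Suc)
  then show ?thesis
    unfolding pow by (simp only:) (rule unitarily_equiv_cadj_design_ext, rule Cdes_carrier[OF k(2)])
qed

text \<open>The conjugation is passed upwards: a swap replaces the inner design by its adjoint and
  conjugates the new variable, and that adjoint is equivalent to \<open>Cdes k\<close>.\<close>

lemma design_ext_Cdes_minus_equiv:
  assumes "1 \<le> k"
  shows "unitarily_equiv (2 ^ k) (\<lambda>z. design_ext (z k) (Cdes_minus k z)) (Cdes_minus (Suc k))"
proof -
  let ?m = "2 ^ (k - 1) :: nat"
  have pow: "(2::nat) ^ k = ?m + ?m"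
    using assms by (simp flip: mult_2 power_Suc)
  have "unitarily_equiv (?m + ?m) (\<lambda>z. design_ext (z k) (Cdes_minus k z))
      (\<lambda>z. design_ext (cnj (z k)) (cadj (Cdes_minus k z)))"
    by (rule unitarily_equiv_design_ext_cadj) (rule Cdes_minus_carrier[OF assms])
  moreover have "unitarily_equiv (?m + ?m) (\<lambda>z. design_ext (cnj (z k)) (cadj (Cdes_minus k z)))
      (\<lambda>z. design_ext (cnj (z k)) (Cdes k z))"
    by (rule unitarily_equiv_design_ext[OF cadj_Cdes_minus_equiv[OF assms] Cdes_carrier[OF assms]])
  ultimately have "unitarily_equiv (?m + ?m) (\<lambda>z. design_ext (z k) (Cdes_minus k z))
      (\<lambda>z. design_ext (cnj (z k)) (Cdes k z))"
    by (rule unitarily_equiv_trans) (rule design_ext_carrier[OF Cdes_carrier[OF assms]])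
  moreover have "Cdes_minus (Suc k) = (\<lambda>z. design_ext (cnj (z k)) (Cdes k z))"
    by (simp add: fun_eq_iff Cdes_minus_Suc[OF assms])
  ultimately show ?thesis
    by (simp add: pow)
qed

section \<open>Block-diagonal canonical designs: existence and uniqueness of the
  multiplicities\<close>

definition canonical_cod :: "nat \<Rightarrow> nat \<Rightarrow> nat \<Rightarrow> (nat \<Rightarrow> complex) \<Rightarrow> complex mat" where
  "canonical_cod k a b z = diag_block_mat (replicate a (Cdes k z) @ replicate b (Cdes_minus k z))"

lemma canonical_cod_carrier:
  assumes "1 \<le> k"
  shows "canonical_cod k a b z \<in> carrier_mat ((a + b) * 2 ^ (k - 1)) ((a + b) * 2 ^ (k - 1))"
  using diag_block_mat_carrier[of "replicate a (Cdes k z) @ replicate b (Cdes_minus k z)" "2 ^ (k - 1)"]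
    Cdes_carrier[OF assms, of z] Cdes_minus_carrier[OF assms, of z]
  by (auto simp: canonical_cod_def)

lemma canonical_cod_cong: "(\<And>i. i < k \<Longrightarrow> z i = z' i) \<Longrightarrow> canonical_cod k a b z = canonical_cod k a b z'"
  using Cdes_cong[of k z z'] Cdes_minus_cong[of k z z'] by (simp add: canonical_cod_def)

lemma diag_block_mat_zero:
  "(\<And>A. A \<in> set As \<Longrightarrow> A = 0\<^sub>m d d) \<Longrightarrow> diag_block_mat As = 0\<^sub>m (length As * d) (length As * d)"
proof (induction As)
  case (Cons A As)
  then have "A = 0\<^sub>m d d" "diag_block_mat As = 0\<^sub>m (length As * d) (length As * d)"
    by simp_all
  then show ?case
    by (simp add: Let_def)
qed simp

lemma canonical_cod_zero:
  assumes "1 \<le> k"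
  shows "canonical_cod k a b (\<lambda>_. 0) = 0\<^sub>m ((a + b) * 2 ^ (k - 1)) ((a + b) * 2 ^ (k - 1))"
  unfolding canonical_cod_def
  using diag_block_mat_zero[of "replicate a (Cdes k (\<lambda>_. 0)) @ replicate b (Cdes_minus k (\<lambda>_. 0))"
      "2 ^ (k - 1)"] Cdes_zero[OF assms] Cdes_minus_zero[OF assms]
  by auto

lemma is_cod_canonical:
  assumes "1 \<le> k"
  shows "is_cod (a * 2 ^ (k - 1)) k (canonical_cod k a 0)"
proof (induction a)
  case 0
  show ?case
    by (auto simp: is_cod_def canonical_cod_def intro!: eq_matI)
next
  case (Suc a)
  then show ?case
    using is_cod_dsum[OF is_cod_Cdes[OF assms] Suc]
    by (simp add: canonical_cod_def diag_block_mat_Cons del: diag_block_mat.simps(2))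
qed

text \<open>The extension distributes over the blocks and preserves the kind of each, so both
  multiplicities survive; both inductions on k rest on this.\<close>

lemma design_ext_canonical_cod:
  assumes "1 \<le> k"
  shows "unitarily_equiv ((a + b) * 2 ^ k) (\<lambda>z. design_ext (z k) (canonical_cod k a b z)) (canonical_cod (Suc k) a b)"
proof -
  let ?m = "2 ^ (k - 1) :: nat"
  have pow: "(2::nat) ^ k = ?m + ?m"
    using assms by (simp flip: mult_2 power_Suc)
  define Fs where "Fs = replicate a (Cdes k) @ replicate b (Cdes_minus k)"
  define Gs where "Gs = replicate a (Cdes (Suc k)) @ replicate b (Cdes_minus (Suc k))"
  define Hs where "Hs = map (\<lambda>F z. design_ext (z k) (F z)) Fs"
  have Fs: "F z \<in> carrier_mat ?m ?m" if "F \<in> set Fs" for F z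
    using that Cdes_carrier[OF assms] Cdes_minus_carrier[OF assms] by (auto simp: Fs_def)
  have Gs: "G z \<in> carrier_mat (2 ^ k) (2 ^ k)" if "G \<in> set Gs" for G z
    using that Cdes_carrier[of "Suc k"] Cdes_minus_carrier[of "Suc k"] by (auto simp: Gs_def)
  have len: "length Fs = a + b" "length Gs = a + b"
    by (simp_all add: Fs_def Gs_def)
  have 1: "unitarily_equiv ((a + b) * 2 ^ k) (\<lambda>z. design_ext (z k) (diag_block_mat (map (\<lambda>F. F z) Fs)))
      (\<lambda>z. diag_block_mat (map (\<lambda>H. H z) Hs))"
    using unitarily_equiv_design_ext_diag_block_mat[where Fs = Fs and d = ?m and w = "\<lambda>z. z k"] Fs
    by (simp add: len pow Hs_def o_def)
  have Cdes: "unitarily_equiv (2 ^ k) (\<lambda>z. design_ext (z k) (Cdes k z)) (Cdes (Suc k))"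
  proof -
    have "(\<lambda>z. design_ext (z k) (Cdes k z)) = Cdes (Suc k)"
      using assms by (intro ext) (simp add: Cdes_Suc)
    moreover have "unitarily_equiv (2 ^ (Suc k - 1)) (Cdes (Suc k)) (Cdes (Suc k))"
      by (intro unitarily_equiv_refl Cdes_carrier) simp
    ultimately show ?thesis
      by simp
  qed
  have "list_all2 (unitarily_equiv (2 ^ k)) Hs Gs"
    unfolding Hs_def Fs_def Gs_def map_append map_replicate
    by (rule list_all2_appendI) (auto simp: list_all2_conv_all_nth Cdes design_ext_Cdes_minus_equiv[OF assms])
  then have 2: "unitarily_equiv ((a + b) * 2 ^ k)
      (\<lambda>z. diag_block_mat (map (\<lambda>H. H z) Hs)) (\<lambda>z. diag_block_mat (map (\<lambda>G. G z) Gs))"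
    using unitarily_equiv_diag_block_mat[where d = "2 ^ k" and Fs = Hs and Gs = Gs] Gs by (simp add: len)
  have "diag_block_mat (map (\<lambda>G. G z) Gs) \<in> carrier_mat ((a + b) * 2 ^ k) ((a + b) * 2 ^ k)" for z
    using diag_block_mat_carrier[of "map (\<lambda>G. G z) Gs" "2 ^ k"] Gs by (auto simp: len)
  from unitarily_equiv_trans[OF 1 2 this] show ?thesis
    by (simp add: Fs_def Gs_def canonical_cod_def[abs_def])
qed

lemma canonical_cod_1:
  "canonical_cod 1 a b z = diag_fun_mat (a + b) (\<lambda>i. if i < a then z 0 else cnj (z 0))"
proof (induction a)
  case 0
  show ?case
  proof (induction b)
    case (Suc b)
    have "canonical_cod 1 0 (Suc b) z = dsum_mat (mat 1 1 (\<lambda>_. cnj (z 0))) (canonical_cod 1 0 b z)"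
      by (simp add: canonical_cod_def Cdes_minus_def diag_block_mat_Cons del: diag_block_mat.simps(2))
    also have "\<dots> = diag_fun_mat (Suc b) (\<lambda>i. if i < 0 then z 0 else cnj (z 0))"
      unfolding Suc by (rule eq_matI) (auto simp: dsum_mat_def)
    finally show ?case
      by simp
  qed (auto simp: canonical_cod_def intro!: eq_matI)
next
  case (Suc a)
  have "canonical_cod 1 (Suc a) b z = dsum_mat (mat 1 1 (\<lambda>_. z 0)) (canonical_cod 1 a b z)"
    by (simp add: canonical_cod_def diag_block_mat_Cons del: diag_block_mat.simps(2))
  also have "\<dots> = diag_fun_mat (Suc a + b) (\<lambda>i. if i < Suc a then z 0 else cnj (z 0))"
    unfolding Suc by (rule eq_matI) (auto simp: dsum_mat_def)
  finally show ?case .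
qed

text \<open>At w = 1 the entries of U and V^H agree; at w = \<i> a nonzero entry of U must then join
  two indices carrying the same kind of variable. Counting the support of U compares a with
  a'.\<close>

lemma canonical_cod_1_unique:
  assumes eq: "unitarily_equiv (a + b) (canonical_cod 1 a b) (canonical_cod 1 a' b')" and "a + b = a' + b'"
  shows "a = a'"
proof -
  define n where "n = a + b"
  obtain U V where U: "unitary_mat n U" and V: "unitary_mat n V"
    and UV: "\<And>z. canonical_cod 1 a b z = U * canonical_cod 1 a' b' z * V"
    using unitarily_equivE[OF eq] unfolding n_def by blast
  note d = unitary_matD[OF U] unitary_matD[OF V]
  have D: "canonical_cod 1 a b z = diag_fun_mat n (\<lambda>i. if i < a then z 0 else cnj (z 0))"
    "canonical_cod 1 a' b' z = diag_fun_mat n (\<lambda>i. if i < a' then z 0 else cnj (z 0))" for z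
    unfolding canonical_cod_1 n_def using assms(2) by simp_all
  have comm: "diag_fun_mat n (\<lambda>i. if i < a then w else cnj w) * cadj V =
      U * diag_fun_mat n (\<lambda>i. if i < a' then w else cnj w)" for w
    using UV[of "\<lambda>_. w"] unfolding D by (simp add: mat_dim_simps d)
  have entry: "(if i < a then w else cnj w) * cadj V $$ (i, j) = U $$ (i, j) * (if j < a' then w else cnj w)"
    if "i < n" "j < n" for w i j
    using arg_cong[OF comm[of w], of "\<lambda>A. A $$ (i, j)"] that
    by (simp add: diag_fun_mat_mult mult_diag_fun_mat d(1,2,7,8) del: index_mult_mat(1))
  have "card {..<a} = card {..<a'}"
  proof (rule unitary_support_card[OF U])
    fix i j assume ij: "i < n" "j < n" "U $$ (i, j) \<noteq> 0"
    show "i \<in> {..<a} \<longleftrightarrow> j \<in> {..<a'}"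
      using entry[OF ij(1,2), of 1] entry[OF ij(1,2), of \<i>] ij(3) by (auto split: if_splits)
  qed (use assms(2) in \<open>auto simp: n_def\<close>)
  then show ?thesis
    by simp
qed

lemma canonical_cod_unique:
  assumes "1 \<le> k" "unitarily_equiv ((a + b) * 2 ^ (k - 1)) (canonical_cod k a b) (canonical_cod k a' b')"
    and sum: "a + b = a' + b'"
  shows "a = a'"
  using assms(1,2)
proof (induction k rule: dec_induct)
  case base
  then show ?case
    using canonical_cod_1_unique[OF _ sum] by simp
next
  case (step k)
  let ?n = "(a + b) * 2 ^ (k - 1)"
  have n: "(a + b) * 2 ^ k = ?n + ?n"
    using step.hyps(1) by (simp flip: mult_2 power_Suc add: algebra_simps)
  note can = design_ext_canonical_cod[OF step.hyps(1)]
  note car = canonical_cod_carrier[OF step.hyps(1)]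
  have car_Suc: "canonical_cod (Suc k) a' b' z \<in> carrier_mat ((a + b) * 2 ^ k) ((a + b) * 2 ^ k)" for z
    using canonical_cod_carrier[of "Suc k" a' b'] by (simp add: sum)
  have ext_car: "design_ext (z k) (canonical_cod k a' b' z) \<in> carrier_mat ((a + b) * 2 ^ k) ((a + b) * 2 ^ k)" for z
    unfolding n using car[of a' b' z] by (auto simp: sum)
  have "unitarily_equiv ((a + b) * 2 ^ k) (\<lambda>z. design_ext (z k) (canonical_cod k a b z)) (canonical_cod (Suc k) a' b')"
    using unitarily_equiv_trans[OF can _ car_Suc] step.prems by simp
  moreover have "unitarily_equiv ((a + b) * 2 ^ k) (canonical_cod (Suc k) a' b') (\<lambda>z. design_ext (z k) (canonical_cod k a' b' z))"
    using unitarily_equiv_sym[OF can[of a' b', folded sum] car_Suc] .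
  ultimately have "unitarily_equiv (?n + ?n) (\<lambda>z. design_ext (z k) (canonical_cod k a b z))
      (\<lambda>z. design_ext (z k) (canonical_cod k a' b' z))"
    using unitarily_equiv_trans[OF _ _ ext_car] n by simp
  \<comment> \<open>Cancellation applies because designs in k variables do not read index k and
    vanish at 0.\<close>
  then have "unitarily_equiv ?n (canonical_cod k a b) (canonical_cod k a' b')"
  proof (rule unitarily_equiv_design_ext_cancel)
    show "canonical_cod k a b z \<in> carrier_mat ?n ?n" "canonical_cod k a' b' z \<in> carrier_mat ?n ?n" for z
      using car[of a b z] car[of a' b' z] by (simp_all add: sum)
    show "canonical_cod k a b (z(k := w)) = canonical_cod k a b z"
      "canonical_cod k a' b' (z(k := w)) = canonical_cod k a' b' z" for z w
      by (rule canonical_cod_cong, simp)+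
    show "canonical_cod k a b (\<lambda>_. 0) = 0\<^sub>m ?n ?n" "canonical_cod k a' b' (\<lambda>_. 0) = 0\<^sub>m ?n ?n"
      using canonical_cod_zero[OF step.hyps(1)] sum by simp_all
  qed
  then show ?case
    by (rule step.IH)
qed

lemma cod_equiv_canonical:
  assumes "1 \<le> k" "is_cod n k F"
  shows "\<exists>a b. n = (a + b) * 2 ^ (k - 1) \<and> unitarily_equiv n F (canonical_cod k a b)"
  using assms
proof (induction k arbitrary: n F rule: dec_induct)
  case base
  then have "is_cod n (Suc 0) F"
    by simp
  then obtain r G where r: "r \<le> n" and G: "is_cod n (Suc 0) G" and FG: "unitarily_equiv n F G"
    and split: "\<And>z. G z = G (z(0 := 0)) + diag_fun_mat n (\<lambda>i. if i < r then z 0 else cnj (z 0))"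
    using cod_normal_form_last[of n 0 F] by blast
  \<comment> \<open>With a single variable nothing is left once it is set to 0, so the normal form
    is already canonical, with multiplicities r and n - r.\<close>
  have zero: "G (z(0 := 0)) = 0\<^sub>m n n" for z
    by (rule eq_matI)
       (use is_codD(4)[OF is_cod_split_last(1)[OF G]] in \<open>auto simp: conj_linear_def is_codD(2,3)[OF G]\<close>)
  have "G = canonical_cod 1 r (n - r)"
  proof
    fix z
    show "G z = canonical_cod 1 r (n - r) z"
      by (subst split) (use r in \<open>simp add: zero canonical_cod_1 del: One_nat_def\<close>)
  qed
  then show ?case
    using FG r by (intro exI[of _ r] exI[of _ "n - r"]) simp
next
  case (step k)
  obtain r Y where n: "n = r + r" and Y: "is_cod r k Y"
    and FY: "unitarily_equiv n F (\<lambda>z. design_ext (z k) (Y z))"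
    using cod_reduction[OF step.prems step.hyps(1)] by blast
  obtain a b where r: "r = (a + b) * 2 ^ (k - 1)" and Ycan: "unitarily_equiv r Y (canonical_cod k a b)"
    using step.IH[OF Y] by blast
  have nab: "n = (a + b) * 2 ^ k"
    unfolding n r using step.hyps(1) by (simp flip: mult_2 power_Suc add: algebra_simps)
  have car: "canonical_cod k a b z \<in> carrier_mat r r" for z
    unfolding r by (rule canonical_cod_carrier[OF step.hyps(1)])
  have "unitarily_equiv n (\<lambda>z. design_ext (z k) (Y z)) (\<lambda>z. design_ext (z k) (canonical_cod k a b z))"
    unfolding n by (rule unitarily_equiv_design_ext[OF Ycan car])
  with FY have "unitarily_equiv n F (\<lambda>z. design_ext (z k) (canonical_cod k a b z))"
    by (rule unitarily_equiv_trans) (simp add: n car)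
  moreover have "unitarily_equiv n (\<lambda>z. design_ext (z k) (canonical_cod k a b z)) (canonical_cod (Suc k) a b)"
    unfolding nab by (rule design_ext_canonical_cod[OF step.hyps(1)])
  ultimately have "unitarily_equiv n F (canonical_cod (Suc k) a b)"
    by (rule unitarily_equiv_trans) (use canonical_cod_carrier[of "Suc k" a b] nab in simp)
  then show ?case
    using nab by auto
qed

theorem theorem1:
  fixes n k :: nat
  assumes "n \<ge> 1" and "k \<ge> 1"
  shows "((\<exists>\<alpha> \<beta>. square_COD n k \<alpha> \<beta>) \<longleftrightarrow> 2 ^ (k - 1) dvd n) \<and>
    (\<forall>\<alpha> \<beta>. square_COD n k \<alpha> \<beta> \<longrightarrow>
       (\<exists>!p :: nat \<times> nat. fst p + snd p = n div 2 ^ (k - 1) \<and>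
          (\<exists>U V. unitary_mat n U \<and> unitary_mat n V \<and>
             (\<forall>z. lin_mat n k \<alpha> \<beta> z =
                  U * diag_block_mat (replicate (fst p) (Cdes k z) @ replicate (snd p) (Cdes_minus k z)) * V))))"
proof (intro conjI iffI allI impI)
  assume "\<exists>\<alpha> \<beta>. square_COD n k \<alpha> \<beta>"
  then show "2 ^ (k - 1) dvd n"
    using cod_equiv_canonical[OF assms(2)] is_cod_lin_mat_iff by (metis dvd_triv_right)
next
  assume "2 ^ (k - 1) dvd n"
  then obtain a where "n = a * 2 ^ (k - 1)"
    by (metis dvdE mult.commute)
  \<comment> \<open>For existence, copies of \<open>Cdes k\<close> alone are enough.\<close>
  then have cod: "is_cod n k (canonical_cod k a 0)"
    using is_cod_canonical[OF assms(2)] by simp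
  then obtain \<alpha> \<beta> where "canonical_cod k a 0 = lin_mat n k \<alpha> \<beta>"
    by (rule is_cod_imp_lin_mat)
  then show "\<exists>\<alpha> \<beta>. square_COD n k \<alpha> \<beta>"
    using cod is_cod_lin_mat_iff by metis
next
  fix \<alpha> \<beta> assume "square_COD n k \<alpha> \<beta>"
  then have "is_cod n k (lin_mat n k \<alpha> \<beta>)"
    by (simp add: is_cod_lin_mat_iff)
  then obtain a b where n: "n = (a + b) * 2 ^ (k - 1)"
    and eq: "unitarily_equiv n (lin_mat n k \<alpha> \<beta>) (canonical_cod k a b)"
    using cod_equiv_canonical[OF assms(2)] by blast
  \<comment> \<open>Two canonical forms of one design are equivalent to each other, with the same
    total number of blocks.\<close>
  have unique: "a' = a \<and> b' = b"
    if sum: "a' + b' = n div 2 ^ (k - 1)" and eq': "unitarily_equiv n (lin_mat n k \<alpha> \<beta>) (canonical_cod k a' b')"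
    for a' b'
  proof -
    have sum': "a + b = a' + b'"
      using sum by (simp add: n)
    have car: "canonical_cod k a b z \<in> carrier_mat n n" for z
      unfolding n by (rule canonical_cod_carrier[OF assms(2)])
    have car': "canonical_cod k a' b' z \<in> carrier_mat n n" for z
      unfolding n sum' by (rule canonical_cod_carrier[OF assms(2)])
    have "unitarily_equiv n (canonical_cod k a b) (canonical_cod k a' b')"
      by (rule unitarily_equiv_trans[OF unitarily_equiv_sym[OF eq car] eq' car'])
    then have "a = a'"
      using canonical_cod_unique[OF assms(2) _ sum'] by (simp add: n)
    then show ?thesis
      using sum' by simp
  qed
  show "\<exists>!p :: nat \<times> nat. fst p + snd p = n div 2 ^ (k - 1) \<and>
      (\<exists>U V. unitary_mat n U \<and> unitary_mat n V \<and>
         (\<forall>z. lin_mat n k \<alpha> \<beta> z =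
              U * diag_block_mat (replicate (fst p) (Cdes k z) @ replicate (snd p) (Cdes_minus k z)) * V))"
    unfolding unitarily_equiv_def[symmetric] canonical_cod_def[symmetric]
  proof (rule ex1I[of _ "(a, b)"])
    show "fst (a, b) + snd (a, b) = n div 2 ^ (k - 1) \<and>
        unitarily_equiv n (lin_mat n k \<alpha> \<beta>) (canonical_cod k (fst (a, b)) (snd (a, b)))"
      using eq by (simp add: n)
  next
    fix p :: "nat \<times> nat"
    assume "fst p + snd p = n div 2 ^ (k - 1) \<and>
        unitarily_equiv n (lin_mat n k \<alpha> \<beta>) (canonical_cod k (fst p) (snd p))"
    then show "p = (a, b)"
      using unique[of "fst p" "snd p"] by (simp add: prod_eq_iff)
  qed
qed

end
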